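(* Let $p$ be an odd prime and $D_{2p}=\langle \tau,\sigma\mid \tau^p=\sigma^2=e,\ \sigma\tau\sigma=\tau^{-1}\rangle$. The number of connected Cayley digraphs on $D_{2p}$ up to isomorphism is $\mathcal{N}_1=\mathcal{N}-\mathcal{N}_c-1$, where $$\mathcal{N}=\frac{1}{p}2^{p}(1-2^{p-1})+\frac{2}{p-1}\sum_{d\mid(p-1)}\Phi(d)\,2^{\frac{2(p-1)}{d}},\qquad \mathcal{N}_c=\frac{1}{p-1}\sum_{d\mid(p-1)}\Phi(d)\,2^{\frac{p-1}{d}},$$ and $\Phi$ is Euler's totient function.
   Context: For a finite group $G$ and $S\subseteq G$ with $e\notin S$, the Cayley digraph $\mathrm{Cay}(G,S)$ has vertex set $G$ and an arc from $g$ to $h$ whenever $hg^{-1}\in S$; it is connected if and only if $\langle S\rangle=G$. Counting is of isomorphism classes of such digraphs with $G=D_{2p}$. *)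

theory Defs
  imports
    Complex_Main
    "HOL-Algebra.Coset"
    "HOL-Number_Theory.Totient"
    "Graph_Theory.Digraph_Isomorphism"
begin

text \<open>
  Groups given by a presentation: the generators are all elements of the type \<open>'g\<close>, the letter
  \<open>(x, True)\<close> stands for the generator \<open>x\<close> and \<open>(x, False)\<close> for its formal inverse, and
  \<open>R\<close> is the set of relators (words that are declared to be trivial).
\<close>

type_synonym 'g word = "('g \<times> bool) list"

inductive word_eq :: "'g word set \<Rightarrow> 'g word \<Rightarrow> 'g word \<Rightarrow> bool" for R where
  word_eq_refl: "word_eq R u u"
| word_eq_sym: "word_eq R u v \<Longrightarrow> word_eq R v u"
| word_eq_trans: "word_eq R u v \<Longrightarrow> word_eq R v w \<Longrightarrow> word_eq R u w"
| word_eq_append: "word_eq R u u' \<Longrightarrow> word_eq R v v' \<Longrightarrow> word_eq R (u @ v) (u' @ v')"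
| word_eq_cancel: "word_eq R [(x, b), (x, \<not> b)] []"
| word_eq_relator: "r \<in> R \<Longrightarrow> word_eq R r []"

definition word_class :: "'g word set \<Rightarrow> 'g word \<Rightarrow> 'g word set" where
  "word_class R u = {v. word_eq R u v}"

definition presented_group :: "'g word set \<Rightarrow> 'g word set monoid" where
  "presented_group R =
     \<lparr>carrier = range (word_class R),
      monoid.mult = (\<lambda>A B. \<Union>u\<in>A. \<Union>v\<in>B. word_class R (u @ v)),
      one = word_class R []\<rparr>"

datatype dihedral_gen = Gen_tau | Gen_sigma

text \<open>The relation \<open>\<sigma>\<tau>\<sigma> = \<tau>\<inverse>\<close> is encoded by the relator \<open>\<sigma>\<tau>\<sigma>\<tau>\<close>.\<close>

definition dihedral_relators :: "nat \<Rightarrow> dihedral_gen word set" where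
  "dihedral_relators n =
     {replicate n (Gen_tau, True),
      replicate 2 (Gen_sigma, True),
      [(Gen_sigma, True), (Gen_tau, True), (Gen_sigma, True), (Gen_tau, True)]}"

text \<open>Indexed by the number of rotations: \<open>D\<^sub>2\<^sub>p\<close> is \<open>dihedral_group p\<close>, of order \<open>2p\<close>.\<close>

definition dihedral_group :: "nat \<Rightarrow> dihedral_gen word set monoid" where
  "dihedral_group n = presented_group (dihedral_relators n)"

definition cayley_digraph :: "('a, 'b) monoid_scheme \<Rightarrow> 'a set \<Rightarrow> ('a, 'a \<times> 'a) pre_digraph" where
  "cayley_digraph G S =
     with_proj \<lparr>pverts = carrier G,
                parcs = {(g, h) \<in> carrier G \<times> carrier G. h \<otimes>\<^bsub>G\<^esub> inv\<^bsub>G\<^esub> g \<in> S}\<rparr>"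

definition connected_cayley_digraphs :: "('a, 'b) monoid_scheme \<Rightarrow> ('a, 'a \<times> 'a) pre_digraph set" where
  "connected_cayley_digraphs G =
     {cayley_digraph G S | S.
        S \<subseteq> carrier G \<and> \<one>\<^bsub>G\<^esub> \<notin> S \<and> Digraph_Component.connected (cayley_digraph G S)}"

definition iso_classes :: "('a, 'b) pre_digraph set \<Rightarrow> ('a, 'b) pre_digraph set set" where
  "iso_classes \<D> = \<D> // {(X, Y) \<in> \<D> \<times> \<D>. digraph_iso X Y}"

definition N_all :: "nat \<Rightarrow> real" where
  "N_all p = 1 / real p * 2 ^ p * (1 - 2 ^ (p - 1))
     + 2 / (real p - 1) * (\<Sum>d | d dvd (p - 1). real (totient d) * 2 ^ (2 * (p - 1) div d))"

definition N_c :: "nat \<Rightarrow> real" where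
  "N_c p = 1 / (real p - 1) * (\<Sum>d | d dvd (p - 1). real (totient d) * 2 ^ ((p - 1) div d))"

lemma word_class_eq_iff: "word_class R u = word_class R v \<longleftrightarrow> word_eq R u v"
proof
  assume "word_class R u = word_class R v"
  moreover have "v \<in> word_class R v" by (simp add: word_class_def word_eq_refl)
  ultimately show "word_eq R u v" by (auto simp: word_class_def)
next
  assume "word_eq R u v"
  then have "word_eq R u w \<longleftrightarrow> word_eq R v w" for w
    using word_eq_sym word_eq_trans by metis
  then show "word_class R u = word_class R v" by (simp add: word_class_def)
qed

lemma word_class_mult:
  "word_class R u \<otimes>\<^bsub>presented_group R\<^esub> word_class R v = word_class R (u @ v)"
proof -
  have "word_class R (a @ b) = word_class R (u @ v)"
    if "a \<in> word_class R u" "b \<in> word_class R v" for a b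
    using that unfolding word_class_eq_iff
    by (simp add: word_class_def word_eq_append word_eq_sym)
  then have "(\<Union>a\<in>word_class R u. \<Union>b\<in>word_class R v. word_class R (a @ b)) =
      (\<Union>a\<in>word_class R u. \<Union>b\<in>word_class R v. word_class R (u @ v))"
    by (intro SUP_cong refl)
  moreover have "u \<in> word_class R u" "v \<in> word_class R v"
    by (simp_all add: word_class_def word_eq_refl)
  ultimately show ?thesis
    unfolding presented_group_def by force
qed

definition word_inv :: "'g word \<Rightarrow> 'g word" where
  "word_inv w = rev (map (\<lambda>(x, b). (x, \<not> b)) w)"

lemma word_inv_left: "word_eq R (word_inv w @ w) []"
proof (induction w)
  case Nil
  then show ?case by (simp add: word_inv_def word_eq_refl)
next
  case (Cons a w)
  obtain x b where a: "a = (x, b)" by (cases a)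
  have "word_eq R ([(x, \<not> b), (x, b)] @ w) ([] @ w)"
    using word_eq_cancel[of R x "\<not> b"] by (intro word_eq_append word_eq_refl) simp
  then have "word_eq R (word_inv w @ [(x, \<not> b), (x, b)] @ w) (word_inv w @ w)"
    by (intro word_eq_append word_eq_refl) simp
  then have "word_eq R (word_inv w @ [(x, \<not> b), (x, b)] @ w) []"
    using Cons by (rule word_eq_trans)
  then show ?case by (simp add: a word_inv_def)
qed

lemma group_presented_group: "group (presented_group R)"
proof (rule groupI)
  fix x assume "x \<in> carrier (presented_group R)"
  then obtain w where w: "x = word_class R w" by (auto simp: presented_group_def)
  have "word_class R (word_inv w) \<otimes>\<^bsub>presented_group R\<^esub> x = \<one>\<^bsub>presented_group R\<^esub>"
    unfolding w word_class_mult by (simp add: presented_group_def word_class_eq_iff word_inv_left)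
  then show "\<exists>y\<in>carrier (presented_group R). y \<otimes>\<^bsub>presented_group R\<^esub> x = \<one>\<^bsub>presented_group R\<^esub>"
    by (auto simp: presented_group_def)
next
  fix x y assume "x \<in> carrier (presented_group R)" "y \<in> carrier (presented_group R)"
  then obtain u v where "x = word_class R u" "y = word_class R v"
    by (auto simp: presented_group_def)
  then show "x \<otimes>\<^bsub>presented_group R\<^esub> y \<in> carrier (presented_group R)"
    by (simp add: word_class_mult) (simp add: presented_group_def)
next
  fix x y z assume "x \<in> carrier (presented_group R)" "y \<in> carrier (presented_group R)"
    "z \<in> carrier (presented_group R)"
  then obtain u v w where "x = word_class R u" "y = word_class R v" "z = word_class R w"
    by (auto simp: presented_group_def)
  then show "x \<otimes>\<^bsub>presented_group R\<^esub> y \<otimes>\<^bsub>presented_group R\<^esub> z =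
      x \<otimes>\<^bsub>presented_group R\<^esub> (y \<otimes>\<^bsub>presented_group R\<^esub> z)"
    by (simp add: word_class_mult)
next
  fix x assume "x \<in> carrier (presented_group R)"
  then obtain w where w: "x = word_class R w" by (auto simp: presented_group_def)
  show "\<one>\<^bsub>presented_group R\<^esub> \<otimes>\<^bsub>presented_group R\<^esub> x = x"
    using word_class_mult[of R "[]" w] by (simp add: w presented_group_def)
qed (simp add: presented_group_def)

lemma group_dihedral_group: "group (dihedral_group n)"
  unfolding dihedral_group_def by (rule group_presented_group)

text \<open>
  The pair \<open>(i, a)\<close> represents \<open>\<tau>\<^sup>i\<close> if \<open>a\<close> is false and \<open>\<tau>\<^sup>i\<sigma>\<close> otherwise; words act from the left.
\<close>

fun dih_act1 :: "dihedral_gen \<times> bool \<Rightarrow> int \<times> bool \<Rightarrow> int \<times> bool" where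
  "dih_act1 (Gen_tau, b) (i, a) = (if b then i + 1 else i - 1, a)"
| "dih_act1 (Gen_sigma, b) (i, a) = (- i, \<not> a)"

definition dih_act :: "dihedral_gen word \<Rightarrow> int \<times> bool \<Rightarrow> int \<times> bool" where
  "dih_act w x = foldr dih_act1 w x"

definition dih_cong :: "nat \<Rightarrow> int \<times> bool \<Rightarrow> int \<times> bool \<Rightarrow> bool" where
  "dih_cong n x y \<longleftrightarrow> [fst x = fst y] (mod int n) \<and> snd x = snd y"

lemma dih_cong_act1: "dih_cong n x y \<Longrightarrow> dih_cong n (dih_act1 l x) (dih_act1 l y)"
  by (cases "(l, x)" rule: dih_act1.cases; cases y)
    (auto simp: dih_cong_def cong_iff_dvd_diff dvd_diff_commute)

lemma dih_cong_act: "dih_cong n x y \<Longrightarrow> dih_cong n (dih_act w x) (dih_act w y)"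
  unfolding dih_act_def by (induction w) (auto intro: dih_cong_act1)

lemma dih_act_append: "dih_act (u @ v) x = dih_act u (dih_act v x)"
  by (simp add: dih_act_def)

lemma dih_act_replicate_Tau: "dih_act (replicate k (Gen_tau, True)) (i, a) = (i + int k, a)"
  by (induction k) (auto simp: dih_act_def)

lemma dih_act_word_eq:
  "word_eq (dihedral_relators n) u v \<Longrightarrow> dih_cong n (dih_act u x) (dih_act v x)"
proof (induction arbitrary: x rule: word_eq.induct)
  case (word_eq_sym u v)
  then show ?case unfolding dih_cong_def by (metis cong_sym)
next
  case (word_eq_trans u v w)
  then show ?case unfolding dih_cong_def by (metis cong_trans)
next
  case (word_eq_append u u' v v')
  then have "dih_cong n (dih_act u (dih_act v x)) (dih_act u (dih_act v' x))"
    by (intro dih_cong_act)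
  with word_eq_append.IH(1)[of "dih_act v' x"] show ?case
    unfolding dih_act_append dih_cong_def by (metis cong_trans)
next
  case (word_eq_cancel y b)
  show ?case by (cases y; cases x) (auto simp: dih_act_def dih_cong_def)
next
  case (word_eq_relator r)
  then show ?case
    by (cases x)
      (auto simp: dihedral_relators_def dih_act_replicate_Tau dih_cong_def numeral_2_eq_2,
        auto simp: dih_act_def cong_iff_dvd_diff)
qed (simp add: dih_cong_def)

definition dih_nf :: "nat \<times> bool \<Rightarrow> dihedral_gen word" where
  "dih_nf = (\<lambda>(k, a). replicate k (Gen_tau, True) @ (if a then [(Gen_sigma, True)] else []))"

lemma dih_act_nf: "dih_act (dih_nf (k, a)) (0, False) = (int k, a)"
proof -
  have "dih_act (if a then [(Gen_sigma, True)] else []) (0, False) = (0, a)"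
    by (simp add: dih_act_def)
  then show ?thesis by (simp add: dih_nf_def dih_act_append dih_act_replicate_Tau)
qed

lemma order_dihedral_group:
  assumes "n > 0"
  shows "order (dihedral_group n) = 2 * n"
proof -
  define R where "R = dihedral_relators n"
  define G where "G = dihedral_group n"
  define t where "t = word_class R [(Gen_tau, True)]"
  define s where "s = word_class R [(Gen_sigma, True)]"
  interpret group G unfolding G_def by (rule group_dihedral_group)
  have G: "G = presented_group R" by (simp add: G_def R_def dihedral_group_def)
  have mult: "word_class R u \<otimes>\<^bsub>G\<^esub> word_class R v = word_class R (u @ v)" for u v
    by (simp add: G word_class_mult)
  have one: "\<one>\<^bsub>G\<^esub> = word_class R []" by (simp add: G presented_group_def)
  have carr[simp]: "word_class R w \<in> carrier G" for w by (simp add: G presented_group_def)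
  have ts[simp]: "t \<in> carrier G" "s \<in> carrier G" by (simp_all add: t_def s_def)
  have rel: "word_class R r = \<one>\<^bsub>G\<^esub>" if "r \<in> R" for r
    using that unfolding one word_class_eq_iff by (rule word_eq_relator)
  have pow: "word_class R (replicate k (Gen_tau, True)) = t [^]\<^bsub>G\<^esub> k" for k :: nat
  proof (induction k)
    case (Suc k)
    have "t [^]\<^bsub>G\<^esub> Suc k = word_class R (replicate k (Gen_tau, True) @ [(Gen_tau, True)])"
      unfolding nat_pow_Suc Suc[symmetric] by (simp only: t_def mult)
    then show ?case by (simp add: replicate_append_same)
  qed (simp add: one)
  have tn: "t [^]\<^bsub>G\<^esub> n = \<one>\<^bsub>G\<^esub>"
    using rel[of "replicate n (Gen_tau, True)"] unfolding pow by (simp add: R_def dihedral_relators_def)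
  have ss: "s \<otimes>\<^bsub>G\<^esub> s = \<one>\<^bsub>G\<^esub>"
    using rel[of "[(Gen_sigma, True), (Gen_sigma, True)]"]
    unfolding s_def mult by (simp add: R_def dihedral_relators_def numeral_2_eq_2)
  have stst: "s \<otimes>\<^bsub>G\<^esub> (t \<otimes>\<^bsub>G\<^esub> (s \<otimes>\<^bsub>G\<^esub> t)) = \<one>\<^bsub>G\<^esub>"
    using rel[of "[(Gen_sigma, True), (Gen_tau, True), (Gen_sigma, True), (Gen_tau, True)]"]
    unfolding s_def t_def mult by (simp add: R_def dihedral_relators_def)
  have inv_letter: "word_class R [(x, False)] = inv\<^bsub>G\<^esub> (word_class R [(x, True)])" for x
  proof (rule inv_equality[symmetric])
    show "word_class R [(x, False)] \<otimes>\<^bsub>G\<^esub> word_class R [(x, True)] = \<one>\<^bsub>G\<^esub>"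
      using word_eq_cancel[of R x False] by (simp add: mult one word_class_eq_iff)
  qed simp_all
  have t': "inv\<^bsub>G\<^esub> t = t [^]\<^bsub>G\<^esub> (n - 1)"
    using tn assms by (intro inv_equality) (auto simp flip: nat_pow_Suc)
  have s': "inv\<^bsub>G\<^esub> s = s" using ss by (intro inv_equality) auto
  have tsi: "s \<otimes>\<^bsub>G\<^esub> t = inv\<^bsub>G\<^esub> t \<otimes>\<^bsub>G\<^esub> s"
  proof -
    have "(s \<otimes>\<^bsub>G\<^esub> t) \<otimes>\<^bsub>G\<^esub> (s \<otimes>\<^bsub>G\<^esub> t) = \<one>\<^bsub>G\<^esub>"
      using stst by (simp add: m_assoc)
    then have "inv\<^bsub>G\<^esub> (s \<otimes>\<^bsub>G\<^esub> t) = s \<otimes>\<^bsub>G\<^esub> t"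
      by (intro inv_equality) auto
    then show ?thesis by (simp add: inv_mult_group s')
  qed
  have nfc: "word_class R (dih_nf (k, a)) = t [^]\<^bsub>G\<^esub> k \<otimes>\<^bsub>G\<^esub> (if a then s else \<one>\<^bsub>G\<^esub>)" for k a
    by (simp add: dih_nf_def pow s_def one[symmetric] flip: mult)
  have powmod: "t [^]\<^bsub>G\<^esub> (k mod n) = t [^]\<^bsub>G\<^esub> k" for k :: nat
  proof -
    have "t [^]\<^bsub>G\<^esub> k = t [^]\<^bsub>G\<^esub> (n * (k div n) + k mod n)" by simp
    also have "\<dots> = t [^]\<^bsub>G\<^esub> (k mod n)"
      by (simp only: nat_pow_mult[symmetric] nat_pow_pow[symmetric] ts tn nat_pow_one
          l_one nat_pow_closed)
    finally show ?thesis by simp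
  qed
  have spow: "s \<otimes>\<^bsub>G\<^esub> t [^]\<^bsub>G\<^esub> k = (t [^]\<^bsub>G\<^esub> (n - 1)) [^]\<^bsub>G\<^esub> k \<otimes>\<^bsub>G\<^esub> s" for k :: nat
  proof (induction k)
    case (Suc k)
    have "s \<otimes>\<^bsub>G\<^esub> t [^]\<^bsub>G\<^esub> Suc k = (s \<otimes>\<^bsub>G\<^esub> t [^]\<^bsub>G\<^esub> k) \<otimes>\<^bsub>G\<^esub> t" by (simp add: m_assoc)
    also have "\<dots> = (t [^]\<^bsub>G\<^esub> (n - 1)) [^]\<^bsub>G\<^esub> k \<otimes>\<^bsub>G\<^esub> (s \<otimes>\<^bsub>G\<^esub> t)"
      unfolding Suc by (simp add: m_assoc)
    also have "\<dots> = (t [^]\<^bsub>G\<^esub> (n - 1)) [^]\<^bsub>G\<^esub> Suc k \<otimes>\<^bsub>G\<^esub> s"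
      by (simp add: tsi t' m_assoc)
    finally show ?case .
  qed simp
  define f where "f = (\<lambda>x. word_class R (dih_nf x))"
  have f_mod: "word_class R (dih_nf (k, a)) \<in> f ` ({..<n} \<times> UNIV)" for k a
    using assms by (intro image_eqI[of _ _ "(k mod n, a)"]) (simp_all add: f_def nfc powmod)
  have s_step: "\<exists>k' a'. s \<otimes>\<^bsub>G\<^esub> word_class R (dih_nf (k, a)) = word_class R (dih_nf (k', a'))" for k a
  proof (intro exI)
    show "s \<otimes>\<^bsub>G\<^esub> word_class R (dih_nf (k, a)) = word_class R (dih_nf ((n - 1) * k, \<not> a))"
      using spow[of k] ss
      by (simp add: nfc nat_pow_pow m_assoc[symmetric]) (simp add: m_assoc)
  qed
  have t_step: "t [^]\<^bsub>G\<^esub> m \<otimes>\<^bsub>G\<^esub> word_class R (dih_nf (k, a)) = word_class R (dih_nf (m + k, a))"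
    for m k a
    by (simp add: nfc m_assoc[symmetric] nat_pow_mult)
  have nf: "\<exists>k a. word_class R w = word_class R (dih_nf (k, a))" for w
  proof (induction w)
    case Nil
    show ?case by (intro exI[of _ 0] exI[of _ False]) (simp add: dih_nf_def)
  next
    case (Cons l w)
    then obtain k a where ka: "word_class R w = word_class R (dih_nf (k, a))" by auto
    obtain x b where l: "l = (x, b)" by (cases l)
    have "word_class R (l # w) = word_class R [l] \<otimes>\<^bsub>G\<^esub> word_class R w" by (simp add: mult)
    also have "\<dots> = word_class R [l] \<otimes>\<^bsub>G\<^esub> word_class R (dih_nf (k, a))" by (simp add: ka)
    also have "\<exists>k' a'. \<dots> = word_class R (dih_nf (k', a'))"
    proof (cases x)
      case Gen_sigma
      then have "word_class R [l] = s"
        using inv_letter[of Gen_sigma] by (cases b) (auto simp: l s' simp flip: s_def)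
      then show ?thesis using s_step by simp
    next
      case Gen_tau
      then have "word_class R [l] = t [^]\<^bsub>G\<^esub> (if b then 1 else n - 1)"
        using inv_letter[of Gen_tau] by (cases b) (auto simp: l t' simp flip: t_def)
      then show ?thesis using t_step by metis
    qed
    finally show ?case .
  qed
  have "carrier G = f ` ({..<n} \<times> UNIV)"
  proof
    show "carrier G \<subseteq> f ` ({..<n} \<times> UNIV)"
    proof
      fix y assume "y \<in> carrier G"
      then obtain w where "y = word_class R w" by (auto simp: G presented_group_def)
      with nf[of w] f_mod show "y \<in> f ` ({..<n} \<times> UNIV)" by metis
    qed
  qed (auto simp: f_def)
  moreover have "inj_on f ({..<n} \<times> UNIV)"
  proof (rule inj_onI)
    fix x y assume xy: "x \<in> {..<n} \<times> (UNIV :: bool set)" "y \<in> {..<n} \<times> (UNIV :: bool set)" "f x = f y"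
    obtain k a l b where kl: "x = (k, a)" "y = (l, b)" by (cases x; cases y)
    have "word_eq R (dih_nf x) (dih_nf y)" using xy(3) by (simp add: f_def word_class_eq_iff)
    then have "dih_cong n (int k, a) (int l, b)"
      using dih_act_word_eq[of n "dih_nf x" "dih_nf y" "(0, False)"] by (simp add: R_def kl dih_act_nf)
    then show "x = y" using xy(1,2) by (auto simp: kl dih_cong_def cong_def simp flip: of_nat_mod)
  qed
  ultimately have "order G = card ({..<n} \<times> (UNIV :: bool set))"
    unfolding order_def by (simp add: card_image)
  then show ?thesis by (simp add: G_def card_cartesian_product)
qed

lemma equiv_digraph_iso:
  assumes "\<And>X. X \<in> \<D> \<Longrightarrow> wf_digraph X"
  shows "equiv \<D> {(X, Y) \<in> \<D> \<times> \<D>. digraph_iso X Y}"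
proof (rule equivI)
  show "refl_on \<D> {(X, Y) \<in> \<D> \<times> \<D>. digraph_iso X Y}"
  proof (rule refl_onI)
    fix X assume X: "X \<in> \<D>"
    define f where "f = \<lparr>iso_verts = id, iso_arcs = id, iso_head = head X, iso_tail = tail X\<rparr>"
    have "pre_digraph.digraph_isomorphism X f" "X = app_iso f X"
      using assms[OF X] by (auto simp: f_def pre_digraph.digraph_isomorphism_def app_iso_def)
    with X show "(X, X) \<in> {(X, Y) \<in> \<D> \<times> \<D>. digraph_iso X Y}"
      by (auto simp: digraph_iso_def)
  qed
  show "sym {(X, Y) \<in> \<D> \<times> \<D>. digraph_iso X Y}"
    using assms by (auto simp: sym_def intro: digraph_iso_swap)
  show "trans {(X, Y) \<in> \<D> \<times> \<D>. digraph_iso X Y}"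
    by (auto simp: trans_def intro: digraph_iso_trans)
qed auto

lemma wf_cayley_digraph: "wf_digraph (cayley_digraph G S)"
  by unfold_locales (auto simp: cayley_digraph_def)

end

theory Submission
  imports
    Defs
    "HOL-Algebra.Group_Action"
    "HOL-Algebra.Sylow"
    "HOL-Combinatorics.Permutations"
    "HOL-Number_Theory.Residue_Primitive_Roots"
begin

text \<open>
  The group \<open>D\<^sub>2\<^sub>p\<close> has the CI property for digraphs: if \<open>Cay(D\<^sub>2\<^sub>p, S)\<close> and \<open>Cay(D\<^sub>2\<^sub>p, T)\<close> are isomorphic,
  then some automorphism of \<open>D\<^sub>2\<^sub>p\<close> maps \<open>S\<close> to \<open>T\<close>. Indeed, right multiplication \<open>\<rho>\<close> by \<open>\<tau>\<close> and its
  conjugate under the isomorphism are automorphisms of order \<open>p\<close> of the first digraph, so by Sylow's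
  theorem both may be assumed to lie in one Sylow \<open>p\<close>-subgroup. Since \<open>2p < p\<^sup>2\<close>, its orbits are the
  rotations and the reflections, and it acts on each of them as the powers of \<open>\<rho>\<close>; thus the isomorphism
  is affine on both orbits. The automorphism group of \<open>D\<^sub>2\<^sub>p\<close> is the affine group over \<open>\<int>/p\<close>, acting
  linearly on the rotations and affinely on the reflections, and Burnside's lemma counts its orbits on
  generating sets. An affine map with multiplier of order \<open>d\<close> fixes \<open>2\<^bsup>(p-1)/d\<^esup>\<close> sets of
  rotations and \<open>2\<^bsup>(p-1)/d + 1\<^esup>\<close> sets of reflections, except that a nontrivial translation fixes only
  \<open>2\<close> of the latter; the terms \<open>N\<^sub>c\<close> and \<open>1\<close> come from the sets of rotations and the single reflections.
\<close>

section \<open>Orbits of constant length and Sylow subgroups\<close>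

text \<open>Every orbit of \<open>f\<close> on \<open>X\<close> has exactly \<open>d\<close>
  elements, so the orbits cut \<open>X\<close> into \<open>card X div d\<close> blocks. The
  invariant subsets are the unions of blocks, one for each set of blocks.\<close>

lemma
  fixes f :: "'a \<Rightarrow> 'a"
  assumes fin: "finite X" and maps: "\<And>x. x \<in> X \<Longrightarrow> f x \<in> X" and d: "d > 0"
    and per: "\<And>x. x \<in> X \<Longrightarrow> (f ^^ d) x = x"
    and free: "\<And>x k. x \<in> X \<Longrightarrow> 0 < k \<Longrightarrow> k < d \<Longrightarrow> (f ^^ k) x \<noteq> x"
  shows uniform_orbits_dvd: "d dvd card X"
    and card_invariant_subsets: "card {S. S \<subseteq> X \<and> f ` S = S} = 2 ^ (card X div d)"
proof -
  define orb where "orb x = (\<lambda>k. (f ^^ k) x) ` {..<d}" for x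
  have pow_in: "(f ^^ k) x \<in> X" if "x \<in> X" for x k
    using that by (induction k) (auto intro: maps)
  have pow_orb: "(f ^^ k) x \<in> orb x" if "x \<in> X" for x k
  proof -
    have "(f ^^ k) x = (f ^^ (k mod d)) x"
      using per[OF that] by (simp add: funpow_mod_eq)
    then show ?thesis using d by (auto simp: orb_def)
  qed
  have orb_sub: "orb x \<subseteq> X" if "x \<in> X" for x
    using pow_in that by (auto simp: orb_def)
  have self: "x \<in> orb x" if "x \<in> X" for x
    using pow_orb[OF that, of 0] by simp
  have card_orb: "card (orb x) = d" if x: "x \<in> X" for x
  proof -
    have "False" if "i < j" "j < d" "(f ^^ i) x = (f ^^ j) x" for i j
    proof -
      \<comment> \<open>If steps \<open>i < j\<close> coincide, running on for \<open>d - j\<close>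
        more steps brings \<open>x\<close> back to itself after \<open>d - j + i\<close> steps, too
        early for \<open>free\<close>.\<close>
      have "(f ^^ (d - j + i)) x = (f ^^ (d - j)) ((f ^^ i) x)" by (simp add: funpow_add)
      also have "\<dots> = (f ^^ (d - j + j)) x" using that by (simp only: funpow_add o_apply)
      finally have "(f ^^ (d - j + i)) x = x" using that per[OF x] by simp
      moreover have "0 < d - j + i" "d - j + i < d" using that by linarith+
      ultimately show False using free[OF x, of "d - j + i"] by metis
    qed
    then have "inj_on (\<lambda>k. (f ^^ k) x) {..<d}"
      by (intro linorder_inj_onI) (metis lessThan_iff, auto)
    then show ?thesis by (simp add: orb_def card_image)
  qed
  have orb_mono: "orb y \<subseteq> orb x" if x: "x \<in> X" and y: "y \<in> orb x" for x y
  proof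
    fix z assume "z \<in> orb y"
    then obtain i j where "z = (f ^^ i) y" "y = (f ^^ j) x" using y unfolding orb_def by blast
    then have "z = (f ^^ (i + j)) x" by (simp add: funpow_add)
    then show "z \<in> orb x" using pow_orb x by simp
  qed
  have finorb: "finite (orb x)" for x by (simp add: orb_def)
  have orb_eq: "orb y = orb x" if "x \<in> X" "y \<in> orb x" for x y
    using that orb_mono[OF that] orb_sub card_orb finorb by (metis card_subset_eq subsetD)
  have disj: "C \<inter> D = {}" if C: "C \<in> orb ` X" and D: "D \<in> orb ` X" and ne: "C \<noteq> D" for C D
  proof -
    obtain x y where "x \<in> X" "C = orb x" "y \<in> X" "D = orb y" using C D by auto
    then show ?thesis using orb_eq ne by (metis disjoint_iff)
  qed
  have un: "\<Union> (orb ` X) = X" using orb_sub self by blast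
  have card: "d * card (orb ` X) = card X"
  proof -
    have "d * card (orb ` X) = card (\<Union> (orb ` X))"
      by (rule card_partition[OF _ _ _ disj]) (use fin un card_orb in auto)
    then show ?thesis by (simp add: un)
  qed
  then show "d dvd card X" by (metis dvd_triv_left)
  have "bij_betw \<Union> (Pow (orb ` X)) {S. S \<subseteq> X \<and> f ` S = S}"
  proof (rule bij_betw_imageI)
    show "inj_on \<Union> (Pow (orb ` X))"
    proof (rule inj_onI)
      have *: "K \<subseteq> L" if K: "K \<subseteq> orb ` X" and L: "L \<subseteq> orb ` X" and eq: "\<Union>K = \<Union>L" for K L
      proof
        fix C assume C: "C \<in> K"
        then obtain x where x: "x \<in> X" "C = orb x" using K by auto
        then have "x \<in> \<Union>K" using C self by blast
        then have "x \<in> \<Union>L" by (simp only: eq)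
        then obtain y where y: "y \<in> X" "orb y \<in> L" "x \<in> orb y" using L by blast
        then show "C \<in> L" using orb_eq x by metis
      qed
      fix K L assume "K \<in> Pow (orb ` X)" "L \<in> Pow (orb ` X)" "\<Union>K = \<Union>L"
      then show "K = L" using *[of K L] *[of L K] by blast
    qed
    show "\<Union> ` Pow (orb ` X) = {S. S \<subseteq> X \<and> f ` S = S}"
    proof (intro equalityI subsetI)
      fix S assume "S \<in> \<Union> ` Pow (orb ` X)"
      then obtain Y where Y: "Y \<subseteq> X" "S = \<Union> (orb ` Y)"
        by (auto simp: subset_image_iff)
      have "f ` orb y = orb y" if y: "y \<in> X" for y
      proof
        show "f ` orb y \<subseteq> orb y"
          using pow_orb[OF y, of "Suc k" for k] by (auto simp: orb_def[of y])
        show "orb y \<subseteq> f ` orb y"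
        proof
          fix z assume z: "z \<in> orb y"
          then have zX: "z \<in> X" using orb_sub y by auto
          \<comment> \<open>On \<open>X\<close> the iterate \<open>f ^^ (d - 1)\<close> inverts
            \<open>f\<close>, which supplies preimages inside the orbit.\<close>
          have "f ((f ^^ (d - 1)) z) = (f ^^ Suc (d - 1)) z" by simp
          also have "\<dots> = z" using d per[OF zX] by simp
          finally show "z \<in> f ` orb y"
            using pow_orb[OF zX, of "d - 1"] orb_eq[OF y z] by (metis imageI)
        qed
      qed
      then have "f ` S = S" using Y by (simp add: image_UN subset_eq)
      then show "S \<in> {S. S \<subseteq> X \<and> f ` S = S}" using Y orb_sub by blast
    next
      fix S assume "S \<in> {S. S \<subseteq> X \<and> f ` S = S}"
      then have S: "S \<subseteq> X" "f ` S = S" by auto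
      have "(f ^^ k) x \<in> S" if "x \<in> S" for x k
        using that S(2) by (induction k) auto
      then have "\<Union> (orb ` S) = S" using self S(1) by (auto simp: orb_def[abs_def]) blast
      then show "S \<in> \<Union> ` Pow (orb ` X)" using S(1) by (intro image_eqI[of _ _ "orb ` S"]) auto
    qed
  qed
  from bij_betw_same_card[OF this] have "card {S. S \<subseteq> X \<and> f ` S = S} = 2 ^ card (orb ` X)"
    using fin by (simp add: card_Pow)
  then show "card {S. S \<subseteq> X \<and> f ` S = S} = 2 ^ (card X div d)"
    using card d by (metis nonzero_mult_div_cancel_left not_gr_zero)
qed

text \<open>Orbit lengths divide the prime \<open>p\<close>. Without a fixed point all of them equal
  \<open>p\<close>, and then \<open>p\<close> divides \<open>card X\<close>.\<close>

lemma exists_fixed_point_of_prime_period: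
  fixes f :: "'a \<Rightarrow> 'a"
  assumes "finite X" "\<And>x. x \<in> X \<Longrightarrow> f x \<in> X" "\<And>x. x \<in> X \<Longrightarrow> (f ^^ p) x = x"
    and p: "prime p" and ndvd: "\<not> p dvd card X"
  shows "\<exists>x\<in>X. f x = x"
proof (rule ccontr)
  assume no: "\<not> ?thesis"
  have "(f ^^ k) x \<noteq> x" if x: "x \<in> X" and k: "0 < k" "k < p" for x k
  proof
    assume fx: "(f ^^ k) x = x"
    have "coprime k p"
      using p k by (metis coprime_commute nat_dvd_not_less prime_imp_coprime)
    \<comment> \<open>By Bezout, a return after \<open>k\<close> steps and one after
      \<open>p\<close> steps combine to a return after a single step.\<close>
    then obtain a b where ab: "a * k = b * p + 1"
      using bezout_nat[of k p] k by (metis coprime_imp_gcd_eq_1 mult.commute not_gr_zero)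
    have pow_fix: "(g ^^ n) x = x" if "g x = x" for g :: "'a \<Rightarrow> 'a" and n
      using that by (induction n) auto
    have "(f ^^ (a * k)) x = x" using pow_fix[of "f ^^ k" a] fx by (simp add: funpow_mult mult.commute)
    moreover have "(f ^^ (b * p)) x = x"
      using pow_fix[of "f ^^ p" b] assms(3)[OF x] by (simp add: funpow_mult mult.commute)
    ultimately have "f x = x" by (simp add: ab)
    then show False using no x by blast
  qed
  then have "p dvd card X"
    using assms prime_gt_0_nat[OF p] by (intro uniform_orbits_dvd[of X f]) auto
  then show False using ndvd by blast
qed

text \<open>Right multiplication by \<open>r\<close> acts on the \<open>m\<close> cosets of
  \<open>P\<close> with trivial \<open>p\<close>-th power. As \<open>p\<close> does not divide
  \<open>m\<close>, some coset \<open>P #> x\<close> is fixed, and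
  \<open>P #> (x \<otimes> r) = P #> x\<close> says that the conjugate of \<open>r\<close> by
  \<open>x\<close> lies in \<open>P\<close>.\<close>

lemma (in group) sylow_conjugate_element:
  assumes fin: "finite (carrier G)" and P: "subgroup P G" and ord: "order G = card P * m"
    and p: "prime p" "\<not> p dvd m" and r: "r \<in> carrier G" "r [^] (p::nat) = \<one>"
  shows "\<exists>x\<in>carrier G. x \<otimes> r \<otimes> inv x \<in> P"
proof -
  have PG: "P \<subseteq> carrier G" using P by (rule subgroup.subset)
  have "card P > 0" using P fin PG by (metis card_gt_0_iff empty_iff finite_subset subgroup.one_closed)
  moreover have "card (rcosets P) * card P = order G" using lagrange[OF P] .
  ultimately have m: "card (rcosets P) = m" using ord by (simp add: mult.commute)
  define f where "f C = C #> r" for C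
  have iter: "(f ^^ k) (P #> x) = P #> (x \<otimes> r [^] k)" if "x \<in> carrier G" for x k
    using that r PG by (induction k) (simp_all add: f_def coset_mult_assoc m_assoc)
  have "\<exists>C\<in>rcosets P. f C = C"
  proof (rule exists_fixed_point_of_prime_period[where p = p])
    show "finite (rcosets P)" using fin by (simp add: RCOSETS_def)
    show "f C \<in> rcosets P" if "C \<in> rcosets P" for C
      using that iter[of _ 1] r by (auto simp: RCOSETS_def)
    show "(f ^^ p) C = C" if "C \<in> rcosets P" for C
      using that iter r by (auto simp: RCOSETS_def)
  qed (use p m in auto)
  then obtain x where x: "x \<in> carrier G" "P #> (x \<otimes> r) = P #> x"
    using r PG by (auto simp: RCOSETS_def f_def coset_mult_assoc)
  then have "x \<otimes> r \<in> P #> x" using rcos_self[OF _ P, of "x \<otimes> r"] r by auto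
  then obtain h where h: "h \<in> P" "x \<otimes> r = h \<otimes> x" by (auto simp: r_coset_def)
  then have "x \<otimes> r \<otimes> inv x = h" using x PG by (auto simp: m_assoc)
  then show ?thesis using h(1) x(1) by blast
qed

text \<open>Sylow's theorem gives some subgroup \<open>H\<close> of order \<open>p ^ a\<close>; a
  conjugate of \<open>r\<close> lies in \<open>H\<close>, and conjugating \<open>H\<close> back
  captures \<open>r\<close> itself.\<close>

lemma (in group) sylow_subgroup_containing:
  assumes fin: "finite (carrier G)" and p: "prime p" and ord: "order G = p ^ a * m" "\<not> p dvd m"
    and r: "r \<in> carrier G" "r [^] (p::nat) = \<one>"
  shows "\<exists>P. subgroup P G \<and> card P = p ^ a \<and> r \<in> P"
proof -
  obtain H where H: "subgroup H G" "card H = p ^ a"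
    using sylow_thm[OF p is_group ord(1) fin] by blast
  have HG: "H \<subseteq> carrier G" using H(1) by (rule subgroup.subset)
  obtain x where x: "x \<in> carrier G" "x \<otimes> r \<otimes> inv x \<in> H"
    using sylow_conjugate_element[OF fin H(1) _ p ord(2) r] H(2) ord(1) by auto
  have conj: "inv x <# H #> x = (\<lambda>h. inv x \<otimes> h \<otimes> x) ` H"
    by (auto simp: l_coset_def r_coset_def)
  have "inj_on (\<lambda>h. inv x \<otimes> h \<otimes> x) H"
    using x(1) HG by (auto intro!: inj_onI simp: subset_eq)
  then have "card (inv x <# H #> x) = p ^ a" using H(2) by (simp add: conj card_image)
  moreover have "r \<in> inv x <# H #> x"
    unfolding conj by (rule image_eqI[OF _ x(2)]) (use x r in \<open>simp add: m_assoc inv_solve_left\<close>)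
  ultimately show ?thesis using subgroup_conjugation_is_surj1[OF x(1) H(1)] by blast
qed

text \<open>Both pieces are mapped into themselves and are disjoint, so a point of one piece can
  only be hit from that piece. Hence an invariant set is a free choice of invariant traces on
  \<open>X\<close> and \<open>Y\<close>.\<close>

lemma card_invariant_subsets_Un:
  assumes disj: "X \<inter> Y = {}" and f: "f ` X \<subseteq> X" "f ` Y \<subseteq> Y"
  shows "card {S. S \<subseteq> X \<union> Y \<and> f ` S = S} =
    card {S. S \<subseteq> X \<and> f ` S = S} * card {S. S \<subseteq> Y \<and> f ` S = S}"
proof -
  have "bij_betw (\<lambda>(S, T). S \<union> T) ({S. S \<subseteq> X \<and> f ` S = S} \<times> {S. S \<subseteq> Y \<and> f ` S = S})
      {S. S \<subseteq> X \<union> Y \<and> f ` S = S}"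
  proof (rule bij_betw_byWitness[where f' = "\<lambda>S. (S \<inter> X, S \<inter> Y)"])
    have restr: "f ` (S \<inter> Z) = S \<inter> Z"
      if S: "S \<subseteq> Z \<union> W" "f ` S = S" and ZW: "Z \<inter> W = {}" "f ` Z \<subseteq> Z" "f ` W \<subseteq> W" for S Z W
    proof
      show "f ` (S \<inter> Z) \<subseteq> S \<inter> Z" using S ZW by blast
      show "S \<inter> Z \<subseteq> f ` (S \<inter> Z)"
      proof
        fix z assume z: "z \<in> S \<inter> Z"
        then have "z \<in> f ` S" by (simp add: S(2))
        then obtain w where w: "w \<in> S" "z = f w" by (elim imageE)
        then have "w \<in> Z" using S(1) ZW z by blast
        then show "z \<in> f ` (S \<inter> Z)" using w by blast
      qed
    qed
    show "(\<lambda>S. (S \<inter> X, S \<inter> Y)) ` {S. S \<subseteq> X \<union> Y \<and> f ` S = S}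
        \<subseteq> {S. S \<subseteq> X \<and> f ` S = S} \<times> {S. S \<subseteq> Y \<and> f ` S = S}"
    proof (rule image_subsetI)
      fix S assume "S \<in> {S. S \<subseteq> X \<union> Y \<and> f ` S = S}"
      then show "(S \<inter> X, S \<inter> Y) \<in> {S. S \<subseteq> X \<and> f ` S = S} \<times> {S. S \<subseteq> Y \<and> f ` S = S}"
        using restr[of S X Y] restr[of S Y X] f disj by (simp add: Un_commute Int_commute)
    qed
    show "(\<lambda>(S, T). S \<union> T) ` ({S. S \<subseteq> X \<and> f ` S = S} \<times> {S. S \<subseteq> Y \<and> f ` S = S})
        \<subseteq> {S. S \<subseteq> X \<union> Y \<and> f ` S = S}"
      by (auto simp: image_Un simp del: image_subset_iff)
  qed (use disj in auto)
  then show ?thesis by (simp add: bij_betw_same_card[symmetric] card_cartesian_product)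
qed

section \<open>Permutation groups and automorphism groups of relations\<close>

text \<open>A bare set of functions, so that a stabilizer is a set comprehension and an orbit is an
  image under evaluation.\<close>

definition perm_group :: "('a \<Rightarrow> 'a) set \<Rightarrow> bool" where
  "perm_group P \<longleftrightarrow> id \<in> P \<and> (\<forall>g\<in>P. bij g \<and> inv_into UNIV g \<in> P) \<and> (\<forall>g\<in>P. \<forall>h\<in>P. g \<circ> h \<in> P)"

lemma perm_group_stabilizer: "perm_group P \<Longrightarrow> perm_group {g \<in> P. g v = v}"
  unfolding perm_group_def by (auto simp: bij_is_inj inv_f_eq)

text \<open>The fibre of evaluation at \<open>v\<close> over \<open>h v\<close> is the coset of the
  stabilizer by \<open>h\<close>. All fibres thus have the same size, and there is one for each
  point of the orbit.\<close>

lemma perm_group_orbit_stabilizer: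
  assumes P: "perm_group P" and fin: "finite P"
  shows "card P = card ((\<lambda>g. g v) ` P) * card {g \<in> P. g v = v}"
proof -
  have fib: "card {g \<in> P. g v = h v} = card {g \<in> P. g v = v}" if h: "h \<in> P" for h
  proof -
    have bh: "bij h" and ih: "inv_into UNIV h \<in> P" using P h by (auto simp: perm_group_def)
    have "bij_betw (\<lambda>g. h \<circ> g) {g \<in> P. g v = v} {g \<in> P. g v = h v}"
    proof (rule bij_betw_byWitness[where f' = "\<lambda>g. inv_into UNIV h \<circ> g"])
      show "\<forall>g\<in>{g \<in> P. g v = v}. inv_into UNIV h \<circ> (h \<circ> g) = g"
        using bh by (auto simp: fun_eq_iff bij_is_inj)
      show "\<forall>g\<in>{g \<in> P. g v = h v}. h \<circ> (inv_into UNIV h \<circ> g) = g"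
        using bh by (auto simp: fun_eq_iff bij_is_surj surj_f_inv_f)
    qed (use P h bh ih in \<open>auto simp: perm_group_def bij_is_inj\<close>)
    then show ?thesis by (rule bij_betw_same_card[symmetric])
  qed
  have "card P = (\<Sum>w\<in>(\<lambda>g. g v) ` P. \<Sum>g | g \<in> P \<and> g v = w. 1)"
    using sum.image_gen[OF fin, of "\<lambda>_. 1::nat" "\<lambda>g. g v"] by simp
  also have "\<dots> = (\<Sum>w\<in>(\<lambda>g. g v) ` P. card {g \<in> P. g v = v})"
    by (intro sum.cong) (auto simp: fib)
  finally show ?thesis by simp
qed

lemma
  assumes "perm_group P" "finite P"
  shows perm_group_card_orbit_dvd: "card ((\<lambda>g. g v) ` P) dvd card P"
    and perm_group_card_stabilizer_dvd: "card {g \<in> P. g v = v} dvd card P"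
  unfolding perm_group_orbit_stabilizer[OF assms, of v] by (rule dvd_triv_left, rule dvd_triv_right)

text \<open>By \<open>permutes\<close>, an automorphism is the identity outside \<open>V\<close>. It
  is then determined by its values on \<open>V\<close>, and composition and
  \<open>inv_into UNIV\<close> on the whole type serve as the group operations.\<close>

definition relation_aut_group :: "'a set \<Rightarrow> ('a \<Rightarrow> 'a \<Rightarrow> bool) \<Rightarrow> ('a \<Rightarrow> 'a) monoid" where
  "relation_aut_group V R =
     \<lparr>carrier = {f. f permutes V \<and> (\<forall>u\<in>V. \<forall>v\<in>V. R (f u) (f v) \<longleftrightarrow> R u v)},
      monoid.mult = (\<circ>), one = id\<rparr>"

lemma relation_aut_group_inv_closed:
  assumes "f \<in> carrier (relation_aut_group V R)"
  shows "inv_into UNIV f \<in> carrier (relation_aut_group V R)"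
proof -
  have f: "f permutes V" "\<And>u v. u \<in> V \<Longrightarrow> v \<in> V \<Longrightarrow> R (f u) (f v) \<longleftrightarrow> R u v"
    using assms by (auto simp: relation_aut_group_def)
  note fi = permutes_inv[OF f(1)]
  have "R (inv_into UNIV f u) (inv_into UNIV f v) \<longleftrightarrow> R u v" if "u \<in> V" "v \<in> V" for u v
    using f(2)[of "inv_into UNIV f u" "inv_into UNIV f v"] that
    by (simp add: permutes_in_image[OF fi] permutes_inverses[OF f(1)])
  then show ?thesis using fi by (auto simp: relation_aut_group_def)
qed

lemma group_relation_aut_group: "group (relation_aut_group V R)"
proof (rule groupI)
  fix f assume f: "f \<in> carrier (relation_aut_group V R)"
  then have "f permutes V" by (simp add: relation_aut_group_def)
  then have "inv_into UNIV f \<otimes>\<^bsub>relation_aut_group V R\<^esub> f = \<one>\<^bsub>relation_aut_group V R\<^esub>"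
    by (simp add: relation_aut_group_def permutes_inv_o)
  then show "\<exists>g\<in>carrier (relation_aut_group V R). g \<otimes>\<^bsub>relation_aut_group V R\<^esub> f = \<one>\<^bsub>relation_aut_group V R\<^esub>"
    using relation_aut_group_inv_closed[OF f] by blast
qed (auto simp: relation_aut_group_def permutes_compose permutes_id permutes_in_image comp_assoc)

lemma relation_aut_group_m_inv:
  assumes "f \<in> carrier (relation_aut_group V R)"
  shows "inv\<^bsub>relation_aut_group V R\<^esub> f = inv_into UNIV f"
proof (rule group.inv_equality[OF group_relation_aut_group])
  have "f permutes V" using assms by (simp add: relation_aut_group_def)
  then show "inv_into UNIV f \<otimes>\<^bsub>relation_aut_group V R\<^esub> f = \<one>\<^bsub>relation_aut_group V R\<^esub>"
    by (simp add: relation_aut_group_def permutes_inv_o)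
qed (use assms relation_aut_group_inv_closed in auto)

lemma finite_relation_aut_group: "finite V \<Longrightarrow> finite (carrier (relation_aut_group V R))"
  using finite_permutations[of V] by (auto simp: relation_aut_group_def elim: rev_finite_subset)

lemma relation_aut_group_pow:
  "f [^]\<^bsub>relation_aut_group V R\<^esub> (n::nat) = f ^^ n"
proof (induction n)
  case (Suc n)
  have "f [^]\<^bsub>relation_aut_group V R\<^esub> Suc n = f [^]\<^bsub>relation_aut_group V R\<^esub> n \<circ> f"
    by (simp add: nat_pow_def relation_aut_group_def)
  then show ?case by (simp add: Suc funpow_swap1 fun_eq_iff)
qed (simp add: nat_pow_def relation_aut_group_def)

lemma perm_group_subgroup:
  assumes P: "subgroup P (relation_aut_group V R)"
  shows "perm_group P"
proof -
  let ?G = "relation_aut_group V R"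
  have "id \<in> P" using subgroup.one_closed[OF P] by (simp add: relation_aut_group_def)
  moreover have "g \<circ> h \<in> P" if "g \<in> P" "h \<in> P" for g h
    using subgroup.m_closed[OF P that] by (simp add: relation_aut_group_def)
  moreover have "inv_into UNIV g \<in> P" "bij g" if g: "g \<in> P" for g
  proof -
    have gc: "g \<in> carrier ?G" using subgroup.mem_carrier[OF P g] .
    show "inv_into UNIV g \<in> P"
      using subgroup.m_inv_closed[OF P g] relation_aut_group_m_inv[OF gc] by simp
    show "bij g" using gc by (auto simp: relation_aut_group_def permutes_bij)
  qed
  ultimately show ?thesis by (auto simp: perm_group_def)
qed

section \<open>Isomorphisms between Cayley digraphs in coordinates\<close>

locale odd_prime =
  fixes p :: nat
  assumes prime: "prime p" and odd: "odd p"
begin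

lemma p_ge_3: "p \<ge> 3"
  using prime odd prime_ge_2_nat[OF prime] by (cases "p = 2") auto

lemma inverse_mod_exists:
  assumes "\<not> int p dvd j"
  obtains i where "[j * i = 1] (mod int p)"
proof -
  have "prime (int p)" using prime by simp
  then have "coprime j (int p)" using assms prime_imp_coprime coprime_commute by blast
  then show thesis using cong_solve_coprime_int that by blast
qed

lemma inverse_mod_not_dvd:
  assumes "[j * i = 1] (mod int p)"
  shows "\<not> int p dvd i"
proof
  assume "int p dvd i"
  then have "[j * i = 0] (mod int p)" by (simp add: cong_0_iff)
  then have "[0 = 1] (mod int p)" using assms by (metis cong_sym cong_trans)
  then show False using p_ge_3 by (simp add: cong_def)
qed

text \<open>The pair \<open>(i, False)\<close> stands for \<open>\<tau>\<^sup>i\<close> and \<open>(i, True)\<close> for \<open>\<tau>\<^sup>i\<sigma>\<close>.\<close>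

definition V :: "(int \<times> bool) set" where "V = {0..<int p} \<times> UNIV"

text \<open>The quotient \<open>v u\<inverse>\<close> in the dihedral group.\<close>

definition arrow :: "int \<times> bool \<Rightarrow> int \<times> bool \<Rightarrow> int \<times> bool" where
  "arrow u v = (if snd u = snd v then ((fst v - fst u) mod int p, False)
                else ((fst u + fst v) mod int p, True))"

text \<open>Right multiplication by \<open>\<tau>\<^sup>k\<close>, extended by the identity outside \<^term>\<open>V\<close>.\<close>

definition rot :: "int \<Rightarrow> int \<times> bool \<Rightarrow> int \<times> bool" where
  "rot k u = (if u \<in> V then ((if snd u then fst u - k else fst u + k) mod int p, snd u) else u)"

text \<open>The automorphism of \<open>D\<^sub>2\<^sub>p\<close> given by \<open>\<tau> \<mapsto> \<tau>\<^sup>m\<close> and \<open>\<sigma> \<mapsto> \<tau>\<^sup>c\<sigma>\<close>.\<close>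

definition aff :: "int \<Rightarrow> int \<Rightarrow> int \<times> bool \<Rightarrow> int \<times> bool" where
  "aff m c v = ((m * fst v + (if snd v then c else 0)) mod int p, snd v)"

lemma finite_V: "finite V" by (simp add: V_def)

lemma mod_in_V [simp]: "(x mod int p, s) \<in> V"
  using p_ge_3 by (simp add: V_def)

lemma zero_in_V: "(0, s) \<in> V"
  using mod_in_V[of 0 s] by simp

lemma aff_mod: "aff m c (x mod int p, s) = aff m c (x, s)"
proof -
  have "(m * (x mod int p) + d) mod int p = (m * x + d) mod int p" for d
    by (metis mod_add_left_eq mod_mult_right_eq)
  then show ?thesis by (simp add: aff_def)
qed

lemma rot_in_V [simp]: "rot k u \<in> V \<longleftrightarrow> u \<in> V"
  by (auto simp: rot_def)

lemma snd_rot [simp]: "snd (rot k u) = snd u"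
  by (simp add: rot_def)

lemma rot_rot: "rot j (rot k u) = rot (j + k) u"
  by (auto simp: rot_def mod_simps algebra_simps)

lemma rot_0 [simp]: "rot 0 = id"
  by (auto simp: rot_def fun_eq_iff V_def)

lemma rot_permutes: "rot k permutes V"
proof (rule bij_imp_permutes)
  show "bij_betw (rot k) V V"
    by (rule bij_betw_byWitness[where f' = "rot (- k)"]) (auto simp: rot_rot)
qed (simp add: rot_def)

lemma rot_funpow: "rot k ^^ n = rot (int n * k)"
  by (induction n) (auto simp: fun_eq_iff rot_rot algebra_simps)

lemma rot_mod: "rot (k mod int p) = rot k"
  by (auto simp: rot_def fun_eq_iff mod_simps)

text \<open>A right factor cancels in the quotient \<open>v u\<inverse>\<close>, so
  \<open>rot k\<close> is an automorphism of every Cayley digraph.\<close>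

lemma arrow_rot: "u \<in> V \<Longrightarrow> v \<in> V \<Longrightarrow> arrow (rot k u) (rot k v) = arrow u v"
  by (auto simp: rot_def arrow_def mod_simps algebra_simps)

lemma rot_transitive:
  assumes "u \<in> V" "v \<in> V" "snd u = snd v"
  obtains k where "rot k u = v"
proof
  show "rot (if snd u then fst u - fst v else fst v - fst u) u = v"
    using assms by (auto simp: rot_def V_def prod_eq_iff)
qed

lemma rot_eq_iff: "u \<in> V \<Longrightarrow> rot j u = rot k u \<longleftrightarrow> [j = k] (mod int p)"
  by (auto simp: rot_def cong_def mod_eq_dvd_iff algebra_simps dvd_diff_commute)

section \<open>p-groups of permutations that contain the rotation\<close>

text \<open>\<open>p \<ge> 3\<close> gives \<open>2 * p < p ^ 2\<close>, so \<open>p\<close> is the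
  only power of \<open>p\<close> in this range. This fixes the orbit lengths below.\<close>

lemma prime_power_between:
  assumes "d dvd p ^ a" "p \<le> d" "d \<le> 2 * p"
  shows "d = p"
proof -
  obtain i where i: "d = p ^ i" using assms(1) divides_primepow_nat[OF prime] by blast
  have "i < 2"
  proof (rule ccontr)
    assume "\<not> i < 2"
    then have "p ^ 2 \<le> d" using i p_ge_3 by (auto intro: power_increasing)
    moreover have "2 * p < p ^ 2" using p_ge_3 by (simp add: power2_eq_square)
    ultimately show False using assms(3) by linarith
  qed
  moreover have "i \<noteq> 0" using i assms(2) p_ge_3 by (cases i) auto
  ultimately have "i = 1" by linarith
  then show ?thesis using i by simp
qed

lemma prime_power_less:
  assumes "d dvd p ^ a" "d < p"
  shows "d = 1"
proof -
  obtain i where i: "d = p ^ i" using assms(1) divides_primepow_nat[OF prime] by blast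
  have "i = 0"
  proof (rule ccontr)
    assume "i \<noteq> 0"
    then have "p ^ 1 \<le> p ^ i" using p_ge_3 by (intro power_increasing) auto
    then show False using i assms(2) by simp
  qed
  then show ?thesis using i by simp
qed

definition side :: "bool \<Rightarrow> (int \<times> bool) set" where "side s = {0..<int p} \<times> {s}"

lemma side_iff: "v \<in> side s \<longleftrightarrow> v \<in> V \<and> snd v = s"
  by (cases v) (auto simp: side_def V_def)

lemma card_side: "card (side s) = p"
  by (simp add: side_def card_cartesian_product)

lemma finite_side: "finite (side s)"
  by (simp add: side_def)

context
  fixes P :: "(int \<times> bool \<Rightarrow> int \<times> bool) set" and a :: nat
  assumes P: "perm_group P" and card_P: "card P = p ^ a" and fin_P: "finite P"
    and P_V: "\<And>g. g \<in> P \<Longrightarrow> g permutes V" and rot_P: "rot 1 \<in> P"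
begin

lemma rot_in_p_group: "rot k \<in> P"
proof -
  have "rot (int n) \<in> P" for n
  proof (induction n)
    case (Suc n)
    have "rot (int (Suc n)) = rot 1 \<circ> rot (int n)" by (auto simp: fun_eq_iff rot_rot)
    moreover have "rot 1 \<circ> rot (int n) \<in> P" using Suc P rot_P unfolding perm_group_def by blast
    ultimately show ?case by metis
  qed (use P in \<open>simp add: perm_group_def id_def\<close>)
  from this[of "nat (k mod int p)"] show ?thesis using p_ge_3 by (simp add: rot_mod)
qed

text \<open>The powers of \<open>rot 1\<close> already sweep out the side of \<open>v\<close>. The
  orbit length is a power of \<open>p\<close> between \<open>p\<close> and
  \<open>card V = 2 * p\<close>, so nothing else is reached.\<close>

lemma p_group_orbit:
  assumes v: "v \<in> V"
  shows "(\<lambda>g. g v) ` P = side (snd v)"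
proof -
  have sub: "side (snd v) \<subseteq> (\<lambda>g. g v) ` P"
  proof
    fix w assume "w \<in> side (snd v)"
    then obtain k where "rot k v = w" using v rot_transitive[of v w] by (auto simp: side_iff)
    then show "w \<in> (\<lambda>g. g v) ` P" using rot_in_p_group by auto
  qed
  have "(\<lambda>g. g v) ` P \<subseteq> V" using P_V v by (auto simp: permutes_in_image)
  then have "card ((\<lambda>g. g v) ` P) \<le> card V"
    by (rule card_mono[OF finite_V])
  then have "card ((\<lambda>g. g v) ` P) \<le> 2 * p"
    by (simp add: V_def card_cartesian_product)
  moreover have "p \<le> card ((\<lambda>g. g v) ` P)"
    using card_mono[OF _ sub] fin_P by (simp add: card_side)
  moreover have "card ((\<lambda>g. g v) ` P) dvd p ^ a"
    using perm_group_card_orbit_dvd[OF P fin_P, of v] by (simp only: card_P)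
  ultimately have "card ((\<lambda>g. g v) ` P) = p" by (intro prime_power_between)
  then show ?thesis using card_subset_eq[OF _ sub] fin_P by (simp add: card_side)
qed

text \<open>The stabilizer of \<open>v\<close> moves \<open>w\<close> only among the
  \<open>p - 1\<close> other points of the side. Its orbit length is a power of \<open>p\<close>
  less than \<open>p\<close>, hence \<open>1\<close>.\<close>

lemma p_group_fixes_side:
  assumes g: "g \<in> P" and v: "v \<in> V" "g v = v" and w: "w \<in> V" "snd w = snd v"
  shows "g w = w"
proof (cases "w = v")
  case False
  let ?Q = "{h \<in> P. h v = v}"
  have Q: "perm_group ?Q" "finite ?Q" using perm_group_stabilizer[OF P] fin_P by auto
  have "card ?Q dvd p ^ a"
    using perm_group_card_stabilizer_dvd[OF P fin_P, of v] by (simp only: card_P)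
  then have dvd: "card ((\<lambda>h. h w) ` ?Q) dvd p ^ a"
    by (rule dvd_trans[OF perm_group_card_orbit_dvd[OF Q]])
  have "(\<lambda>h. h w) ` ?Q \<subseteq> side (snd v) - {v}"
  proof
    fix x assume "x \<in> (\<lambda>h. h w) ` ?Q"
    then obtain h where h: "h \<in> P" "h v = v" "x = h w" by auto
    have "x \<in> side (snd v)" using p_group_orbit[OF w(1)] h w by auto
    moreover have "x \<noteq> v" using False h P_V[OF h(1)] by (metis permutes_inverses(2))
    ultimately show "x \<in> side (snd v) - {v}" by simp
  qed
  then have "card ((\<lambda>h. h w) ` ?Q) \<le> card (side (snd v) - {v})"
    by (intro card_mono) (auto simp: finite_side)
  also have "\<dots> < p" using v p_ge_3 by (simp add: card_side side_iff finite_side)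
  finally have "card ((\<lambda>h. h w) ` ?Q) = 1" using prime_power_less[OF dvd] by simp
  then obtain z where z: "(\<lambda>h. h w) ` ?Q = {z}" by (rule card_1_singletonE)
  have "g w \<in> {z}" unfolding z[symmetric] using g v by blast
  moreover have "id w \<in> {z}" unfolding z[symmetric]
    by (rule imageI) (use P in \<open>simp add: perm_group_def id_def\<close>)
  ultimately show ?thesis by simp
qed (use v in simp)

text \<open>On each side some power of the rotation agrees with \<open>g\<close> at one base point;
  dividing it out leaves an element with a fixed point, which fixes the whole side. The two sides
  may need different exponents, whence \<open>k (snd v)\<close>.\<close>

lemma p_group_element:
  assumes g: "g \<in> P"
  obtains k where "\<And>v. v \<in> V \<Longrightarrow> g v = rot (k (snd v)) v"
proof -
  have "\<exists>k. \<forall>v\<in>V. snd v = s \<longrightarrow> g v = rot k v" for s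
  proof -
    let ?o = "(0, s) :: int \<times> bool"
    have o: "?o \<in> V" by (rule zero_in_V)
    have "g ?o \<in> side s" using p_group_orbit[OF o] g by auto
    then obtain k where k: "rot k ?o = g ?o"
      using rot_transitive[OF o, of "g ?o"] by (auto simp: side_iff)
    have "rot (- k) \<circ> g \<in> P" using P g rot_in_p_group by (auto simp: perm_group_def)
    moreover have "(rot (- k) \<circ> g) ?o = ?o" by (simp add: k[symmetric] rot_rot)
    ultimately have "rot (- k) (g v) = v" if "v \<in> V" "snd v = s" for v
      using p_group_fixes_side[of "rot (- k) \<circ> g" ?o v] o that by simp
    then have "g v = rot k v" if "v \<in> V" "snd v = s" for v
      using that rot_rot[of k "- k" "g v"] by simp
    then show ?thesis by blast
  qed
  then obtain k where "\<forall>s. \<forall>v\<in>V. snd v = s \<longrightarrow> g v = rot (k s) v" by metis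
  then show thesis using that by blast
qed

end

section \<open>Maps that intertwine rotations are affine on each side\<close>

text \<open>Rotations are transitive on a side, so the intertwining relation determines
  \<open>\<psi>\<close> there from its value at \<open>(0, s)\<close>; the slope is the inverse of
  \<open>k s\<close> up to sign. The value \<open>e\<close> records whether \<open>\<psi>\<close>
  swaps rotations and reflections.\<close>

lemma affine_on_sides:
  assumes perm: "\<psi> permutes V" and comm: "\<And>v. v \<in> V \<Longrightarrow> \<psi> (rot (k (snd v)) v) = rot 1 (\<psi> v)"
  shows "\<exists>m c e. (\<forall>s. \<not> int p dvd m s) \<and>
    (\<forall>x s. \<psi> (x mod int p, s) = ((m s * x + c s) mod int p, s \<noteq> e)) \<and>
    ([k False = k True] (mod int p) \<longrightarrow> m False = m True)"
proof -
  have comm_n: "\<psi> (rot (int n * k s) v) = rot (int n) (\<psi> v)" if "v \<in> V" "snd v = s" for n s v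
  proof (induction n)
    case (Suc n)
    have "rot (int (Suc n) * k s) v = rot (k s) (rot (int n * k s) v)"
      by (simp add: rot_rot algebra_simps)
    then have "\<psi> (rot (int (Suc n) * k s) v) = rot 1 (\<psi> (rot (int n * k s) v))"
      using comm[of "rot (int n * k s) v"] that by simp
    then show ?case by (simp add: Suc rot_rot)
  qed simp
  have comm_z: "\<psi> (rot (z * k s) v) = rot z (\<psi> v)" if v: "v \<in> V" "snd v = s" for z s v
  proof -
    have z: "int (nat (z mod int p)) = z mod int p" using p_ge_3 by simp
    have "rot (z mod int p * k s) v = rot (z * k s) v"
      using v by (simp add: rot_eq_iff cong_def mod_simps)
    then show ?thesis using comm_n[OF v, of "nat (z mod int p)"] by (simp only: z rot_mod)
  qed
  have \<psi>_V: "\<psi> v \<in> V \<longleftrightarrow> v \<in> V" for v using perm by (rule permutes_in_image)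
  note o = zero_in_V
  \<comment> \<open>A vanishing shift would make \<open>rot 1\<close> fix the point
    \<open>\<psi> (0, s)\<close>.\<close>
  have k0: "\<not> int p dvd k s" for s
  proof
    assume "int p dvd k s"
    then have "rot (1 * k s) (0, s) = rot 0 (0, s)" using o by (simp add: rot_eq_iff cong_0_iff del: rot_0)
    then have "\<psi> (0, s) = rot 1 (\<psi> (0, s))" using comm_z[OF o, of s s 1] by simp
    then have "[0 = 1] (mod int p)" using rot_eq_iff[of "\<psi> (0, s)" 0 1] o by (simp add: \<psi>_V)
    then show False using p_ge_3 by (simp add: cong_def)
  qed
  \<comment> \<open>The predicate under \<open>SOME\<close> depends only on the residue class of
    \<open>k s\<close>, so congruent shifts get literally the same inverse, as the last clause of
    the claim demands.\<close>
  define l where "l s = (SOME z. [k s * z = 1] (mod int p))" for s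
  have l: "[k s * l s = 1] (mod int p)" for s
  proof -
    have "\<exists>z. [k s * z = 1] (mod int p)" using inverse_mod_exists[OF k0] by blast
    then show ?thesis unfolding l_def by (rule someI_ex)
  qed
  have l0: "\<not> int p dvd l s" for s using l by (rule inverse_mod_not_dvd)
  have step: "\<psi> (rot z (0, s)) = rot (l s * z) (\<psi> (0, s))" for z s
  proof -
    have "[l s * z * k s = 1 * z] (mod int p)"
      using cong_scalar_right[OF l[of s], of z] by (simp add: mult_ac)
    then have "rot (l s * z * k s) (0, s) = rot z (0, s)" using o by (simp add: rot_eq_iff)
    then show ?thesis using comm_z[OF o, of s s "l s * z"] by simp
  qed
  define e where "e = snd (\<psi> (0, False))"
  have sndF: "snd (\<psi> v) = snd (\<psi> (0, snd v))" if v: "v \<in> V" for v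
  proof -
    obtain z where "rot z (0, snd v) = v" using rot_transitive[OF o v] by auto
    then show ?thesis using step[of z "snd v"] by simp
  qed
  \<comment> \<open>If both sides landed on one side, \<open>\<psi>\<close> would miss the other one
    and not be surjective on \<open>V\<close>.\<close>
  have e: "snd (\<psi> (0, s)) = (s \<noteq> e)" for s
  proof (rule ccontr)
    assume "snd (\<psi> (0, s)) \<noteq> (s \<noteq> e)"
    then have s: "s = True" "snd (\<psi> (0, True)) = e" by (auto simp: e_def split: if_splits)
    then have "snd (\<psi> v) = e" if "v \<in> V" for v
      using sndF[OF that] by (cases "snd v") (auto simp: e_def)
    moreover have "\<psi> (inv_into UNIV \<psi> (0, \<not> e)) = (0, \<not> e)" using perm by (simp add: permutes_inverses)
    moreover have "inv_into UNIV \<psi> (0, \<not> e) \<in> V"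
      using permutes_in_image[OF permutes_inv[OF perm]] o by blast
    ultimately show False by fastforce
  qed
  \<comment> \<open>\<open>rot\<close> moves reflections backwards. The signs from the source side
    and the target side cancel unless \<open>\<psi>\<close> swaps the sides.\<close>
  define m where "m s = (if e then - l s else l s)" for s
  define c where "c s = fst (\<psi> (0, s))" for s
  have "\<psi> (x mod int p, s) = ((m s * x + c s) mod int p, s \<noteq> e)" for x s
  proof -
    have \<psi>0: "\<psi> (0, s) = (c s, s \<noteq> e)" using e[of s] by (simp add: c_def prod_eq_iff)
    have "(x mod int p, s) = rot (if s then - x else x) (0, s)" using o by (simp add: rot_def)
    then have "\<psi> (x mod int p, s) = rot (l s * (if s then - x else x)) (c s, s \<noteq> e)"
      by (simp only: step \<psi>0)
    moreover have "(c s, s \<noteq> e) \<in> V" using o[of s] \<psi>_V[of "(0, s)"] by (simp only: \<psi>0)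
    ultimately show ?thesis by (auto simp: rot_def m_def algebra_simps)
  qed
  moreover have "\<not> int p dvd m s" for s using l0 by (simp add: m_def)
  moreover have "m False = m True" if "[k False = k True] (mod int p)"
  proof -
    have "[k False * z = 1] (mod int p) \<longleftrightarrow> [k True * z = 1] (mod int p)" for z
      using cong_scalar_right[OF that, of z] by (metis cong_sym cong_trans)
    then show ?thesis by (simp add: m_def l_def)
  qed
  ultimately show ?thesis by (intro exI[of _ m] exI[of _ c] exI[of _ e]) blast
qed

text \<open>
  Babai's conjugacy argument: up to an automorphism of the source digraph, \<open>\<psi>\<close> conjugates \<^term>\<open>rot 1\<close>
  into a Sylow subgroup containing \<^term>\<open>rot 1\<close>, hence \<open>\<psi>\<close> is affine on each side. If the two slopes
  differ, an automorphism rotates one side and fixes the other pointwise, so the reflections are all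
  in \<open>S\<close> or all outside \<open>S\<close>.
\<close>

theorem connection_sets_affine_equivalent:
  assumes perm: "\<psi> permutes V"
    and iso: "\<And>u v. u \<in> V \<Longrightarrow> v \<in> V \<Longrightarrow> arrow (\<psi> u) (\<psi> v) \<in> T \<longleftrightarrow> arrow u v \<in> S"
  shows "\<exists>m c. \<not> int p dvd m \<and> (\<forall>v\<in>V. aff m c v \<in> T \<longleftrightarrow> v \<in> S)"
proof -
  define X where "X = relation_aut_group V (\<lambda>u v. arrow u v \<in> S)"
  have X_iff: "f \<in> carrier X \<longleftrightarrow> f permutes V \<and> (\<forall>u\<in>V. \<forall>v\<in>V. arrow (f u) (f v) \<in> S \<longleftrightarrow> arrow u v \<in> S)" for f
    by (simp add: X_def relation_aut_group_def)
  have X_mult: "f \<otimes>\<^bsub>X\<^esub> g = f \<circ> g" and X_one: "\<one>\<^bsub>X\<^esub> = id" for f g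
    by (simp_all add: X_def relation_aut_group_def)
  have X_pow: "f [^]\<^bsub>X\<^esub> (n::nat) = f ^^ n" for f n by (simp add: X_def relation_aut_group_pow)
  interpret X: group X unfolding X_def by (rule group_relation_aut_group)
  have fin: "finite (carrier X)" unfolding X_def by (rule finite_relation_aut_group[OF finite_V])
  have in_V: "\<psi> v \<in> V \<longleftrightarrow> v \<in> V" for v using perm by (rule permutes_in_image)
  have rot_X: "rot k \<in> carrier X" for k by (simp add: X_iff rot_permutes arrow_rot)
  have rot_p: "rot 1 ^^ p = id" using rot_mod[of "int p"] by (simp add: rot_funpow)
  \<comment> \<open>The rotation of the target digraph pulled back along \<open>\<psi>\<close>: an
    automorphism of the source digraph whose \<open>p\<close>-th power is trivial.\<close>
  define r where "r = inv_into UNIV \<psi> \<circ> rot 1 \<circ> \<psi>"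
  have \<psi>r: "\<psi> (r v) = rot 1 (\<psi> v)" for v using perm by (simp add: r_def permutes_inverses)
  have r_perm: "r permutes V"
    unfolding r_def by (intro permutes_compose perm rot_permutes permutes_inv)
  have r_X: "r \<in> carrier X"
  proof -
    have "arrow (r u) (r v) \<in> S \<longleftrightarrow> arrow u v \<in> S" if "u \<in> V" "v \<in> V" for u v
      using iso[of "r u" "r v"] iso[of u v] that
      by (simp add: \<psi>r permutes_in_image[OF r_perm] arrow_rot in_V)
    then show ?thesis using r_perm by (simp add: X_iff)
  qed
  have "r ^^ n = inv_into UNIV \<psi> \<circ> rot 1 ^^ n \<circ> \<psi>" for n
    using perm by (induction n) (auto simp: fun_eq_iff permutes_inverses r_def)
  then have r_p: "r ^^ p = id" using perm by (simp add: rot_p permutes_inv_o)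
  have "order X \<noteq> 0" using fin X.one_closed by (auto simp: order_def)
  then obtain q where q: "order X = p ^ multiplicity p (order X) * q" "\<not> p dvd q"
    using multiplicity_decompose'[of "order X" p] prime by (metis not_prime_unit)
  define a where "a = multiplicity p (order X)"
  obtain P where P: "subgroup P X" "card P = p ^ a" "rot 1 \<in> P"
    using X.sylow_subgroup_containing[OF fin prime q rot_X[of 1]]
    by (auto simp: X_pow rot_p X_one a_def)
  obtain y where y: "y \<in> carrier X" "y \<otimes>\<^bsub>X\<^esub> r \<otimes>\<^bsub>X\<^esub> inv\<^bsub>X\<^esub> y \<in> P"
    using X.sylow_conjugate_element[OF fin P(1) _ prime q(2) r_X] q(1) P(2)
    by (auto simp: X_pow r_p X_one a_def)
  have y_perm: "y permutes V" using y(1) by (simp add: X_iff)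
  have y': "inv\<^bsub>X\<^esub> y = inv_into UNIV y"
    using y(1) unfolding X_def by (rule relation_aut_group_m_inv)
  define g where "g = y \<circ> r \<circ> inv_into UNIV y"
  have g: "g \<in> P" using y(2) by (simp add: X_mult y' g_def)
  have g_X: "g \<in> carrier X" using subgroup.mem_carrier[OF P(1) g] .
  \<comment> \<open>Precomposing with an automorphism of the source keeps an isomorphism, and now
    \<open>\<Psi>\<close> conjugates \<open>g\<close>, an element of \<open>P\<close>, to
    \<open>rot 1\<close>.\<close>
  define \<Psi> where "\<Psi> = \<psi> \<circ> inv_into UNIV y"
  have y'_X: "inv_into UNIV y \<in> carrier X" using X.inv_closed[OF y(1)] by (simp add: y')
  have \<Psi>_perm: "\<Psi> permutes V"
    unfolding \<Psi>_def by (intro permutes_compose perm permutes_inv y_perm)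
  have \<Psi>_iso: "arrow (\<Psi> u) (\<Psi> v) \<in> T \<longleftrightarrow> arrow u v \<in> S" if "u \<in> V" "v \<in> V" for u v
  proof -
    have "inv_into UNIV y u \<in> V" "inv_into UNIV y v \<in> V"
      using that permutes_in_image[OF permutes_inv[OF y_perm]] by auto
    then show ?thesis using iso y'_X that by (simp add: \<Psi>_def X_iff)
  qed
  have \<Psi>g: "\<Psi> (g v) = rot 1 (\<Psi> v)" for v
    using y_perm by (simp add: \<Psi>_def g_def permutes_inverses \<psi>r)
  have P_perm: "h permutes V" if "h \<in> P" for h
    using subgroup.mem_carrier[OF P(1) that] by (simp add: X_iff)
  have fin_P: "finite P" using subgroup.subset[OF P(1)] fin by (rule finite_subset)
  have perm_P: "perm_group P" using P(1) unfolding X_def by (rule perm_group_subgroup)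
  obtain k where k: "\<And>v. v \<in> V \<Longrightarrow> g v = rot (k (snd v)) v"
    using p_group_element[OF perm_P P(2) fin_P P_perm P(3) g] by blast
  have comm: "\<Psi> (rot (k (snd v)) v) = rot 1 (\<Psi> v)" if "v \<in> V" for v
    using \<Psi>g[of v] k[OF that] by simp
  have "\<exists>m c e. (\<forall>s. \<not> int p dvd m s) \<and>
      (\<forall>x s. \<Psi> (x mod int p, s) = ((m s * x + c s) mod int p, s \<noteq> e)) \<and>
      ([k False = k True] (mod int p) \<longrightarrow> m False = m True)"
    by (rule affine_on_sides[OF \<Psi>_perm]) (rule comm)
  then obtain m c e where mce: "(\<forall>s. \<not> int p dvd m s) \<and>
      (\<forall>x s. \<Psi> (x mod int p, s) = ((m s * x + c s) mod int p, s \<noteq> e)) \<and>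
      ([k False = k True] (mod int p) \<longrightarrow> m False = m True)"
    by (elim exE)
  have m: "\<not> int p dvd m s" and \<Psi>: "\<Psi> (x mod int p, s) = ((m s * x + c s) mod int p, s \<noteq> e)"
    and meq: "[k False = k True] (mod int p) \<Longrightarrow> m False = m True" for x s
    using mce by blast+
  note o = zero_in_V
  \<comment> \<open>A vertex \<open>v\<close> is also the label of the arrow from
    \<open>(0, False)\<close> to \<open>v\<close>. The image arrow subtracts the offsets within a
    side and adds them across sides, so only reflections are translated, by \<open>C\<close>,
    whether or not the sides are swapped.\<close>
  define C where "C = c False + c True"
  have key: "aff (m (snd v)) C v \<in> T \<longleftrightarrow> v \<in> S" if v: "v \<in> V" for v
  proof -
    obtain x s where xs: "v = (x, s)" "x mod int p = x" using v by (auto simp: V_def)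
    have "arrow (0, False) v = v" using xs by (simp add: arrow_def)
    moreover have "arrow (\<Psi> (0, False)) (\<Psi> v) = aff (m s) C v"
    proof (cases s)
      case True
      then show ?thesis using \<Psi>[of 0 False] \<Psi>[of x s] xs
        by (simp add: arrow_def aff_def C_def mod_simps) (simp add: ac_simps)
    next
      case False
      then show ?thesis using \<Psi>[of 0 False] \<Psi>[of x s] xs
        by (simp add: arrow_def aff_def mod_simps)
    qed
    ultimately show ?thesis using \<Psi>_iso[OF o v, of False] xs by simp
  qed
  have "aff (m False) C v \<in> T \<longleftrightarrow> v \<in> S" if v: "v \<in> V" for v
  proof (cases "[k False = k True] (mod int p) \<or> \<not> snd v")
    case True
    then show ?thesis using key[OF v] meq by (cases "snd v") auto
  next
    case False
    \<comment> \<open>Only reflections with unequal shifts remain. The automorphism \<open>h\<close>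
      fixes \<open>(0, False)\<close> and moves reflections by \<open>j\<close>, so membership in
      \<open>S\<close> is invariant under a shift that is nonzero mod \<open>p\<close>.\<close>
    define j where "j = k True - k False"
    have ndvd: "\<not> int p dvd j" using False by (simp add: j_def cong_iff_dvd_diff dvd_diff_commute)
    define h where "h = rot (- k False) \<circ> g"
    have h_X: "h \<in> carrier X" using X.m_closed[OF rot_X g_X] by (simp add: X_mult h_def)
    have h0: "h (0, False) = (0, False)" using k[OF o] by (simp add: h_def rot_rot)
    have in_S: "arrow (0, False) w \<in> S \<longleftrightarrow> w \<in> S" if "w \<in> V" for w
      using that by (cases w) (auto simp: arrow_def V_def)
    have inv1: "rot j w \<in> S \<longleftrightarrow> w \<in> S" if "w \<in> V" "snd w" for w
    proof -
      have "h w = rot j w" using k[OF that(1)] that by (simp add: h_def rot_rot j_def)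
      moreover have "arrow (h (0, False)) (h w) \<in> S \<longleftrightarrow> arrow (0, False) w \<in> S"
        using h_X o that unfolding X_iff by blast
      ultimately show ?thesis using in_S[of w] in_S[of "rot j w"] that by (simp add: h0)
    qed
    have inv_n: "rot (int n * j) w \<in> S \<longleftrightarrow> w \<in> S" if "w \<in> V" "snd w" for n w
    proof (induction n)
      case (Suc n)
      have "rot (int (Suc n) * j) w = rot j (rot (int n * j) w)" by (simp add: rot_rot algebra_simps)
      then show ?case using inv1[of "rot (int n * j) w"] that Suc by simp
    qed simp
    have const: "w \<in> S \<longleftrightarrow> w' \<in> S" if w: "w \<in> V" "snd w" and w': "w' \<in> V" "snd w'" for w w'
    proof -
      obtain z where z: "rot z w = w'" using rot_transitive[of w w'] w w' by auto
      obtain i where i: "[j * i = 1] (mod int p)" using inverse_mod_exists[OF ndvd] .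
      define n where "n = nat ((i * z) mod int p)"
      have n: "int n = (i * z) mod int p" using p_ge_3 by (simp add: n_def)
      have "[int n * j = z] (mod int p)"
        using cong_scalar_right[OF i, of z] unfolding n by (simp add: cong_def mod_simps mult_ac)
      then have "rot (int n * j) w = w'" using rot_eq_iff[OF w(1)] z by blast
      then show ?thesis using inv_n[OF w, of n] by simp
    qed
    obtain i where i: "[m True * i = 1] (mod int p)" using inverse_mod_exists[OF m] .
    \<comment> \<open>The reflection that slope \<open>m True\<close> sends to the place where slope
      \<open>m False\<close> sends \<open>v\<close>. By \<open>const\<close>, \<open>v\<close> and
      \<open>w\<close> are both in \<open>S\<close> or both outside.\<close>
    define w where "w = ((i * m False * fst v) mod int p, True)"
    have "aff (m False) C v = aff (m True) C w"
    proof -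
      have "[m True * (i * m False * fst v) = m False * fst v] (mod int p)"
        using cong_scalar_right[OF i, of "m False * fst v"] by (simp add: mult_ac)
      then have "[m True * (i * m False * fst v) + C = m False * fst v + C] (mod int p)"
        by (rule cong_add[OF _ cong_refl])
      then show ?thesis using False by (simp add: w_def aff_mod) (simp add: aff_def cong_def)
    qed
    moreover have "w \<in> V" "snd w" by (simp_all add: w_def)
    ultimately show ?thesis using key[of w] const[of w v] False v by simp
  qed
  then show ?thesis using m by blast
qed

section \<open>Affine maps as automorphisms of the dihedral group\<close>

lemma V_mod: "v \<in> V \<Longrightarrow> fst v mod int p = fst v"
  by (auto simp: V_def)

lemma arrow_from_zero: "v \<in> V \<Longrightarrow> arrow (0, False) v = v"
  by (cases v) (auto simp: arrow_def V_def)

lemma aff_in_V [simp]: "aff m c v \<in> V"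
  by (simp add: aff_def)

lemma snd_aff [simp]: "snd (aff m c v) = snd v"
  by (simp add: aff_def)

lemma aff_aff: "aff m c (aff m' c' v) = aff (m * m') (m * c' + c) v"
proof -
  have "aff m c (aff m' c' v) = aff m c (m' * fst v + (if snd v then c' else 0), snd v)"
    unfolding aff_def[of m' c' v] by (rule aff_mod)
  then show ?thesis by (simp add: aff_def algebra_simps)
qed

lemma aff_cong:
  assumes "[m = m'] (mod int p)" "[c = c'] (mod int p)"
  shows "aff m c = aff m' c'"
proof
  fix v
  have "[m * fst v + (if snd v then c else 0) = m' * fst v + (if snd v then c' else 0)] (mod int p)"
    using assms by (intro cong_add cong_mult) auto
  then show "aff m c v = aff m' c' v" by (simp add: aff_def cong_def)
qed

lemma aff_id: "v \<in> V \<Longrightarrow> aff 1 0 v = v"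
  by (cases v) (auto simp: aff_def V_def)

lemma aff_zero: "aff m c (0, False) = (0, False)"
  by (simp add: aff_def)

text \<open>With \<open>i\<close> inverse to \<open>m\<close>, the inverse map has multiplier
  \<open>i\<close> and translation \<open>- (i * c)\<close>. The identities are restricted to
  \<open>V\<close> because \<open>aff\<close> reduces every first coordinate mod
  \<open>p\<close>.\<close>

lemma aff_inverse:
  assumes "\<not> int p dvd m"
  obtains m' c' where "\<not> int p dvd m'"
    "\<forall>v\<in>V. aff m' c' (aff m c v) = v" "\<forall>v\<in>V. aff m c (aff m' c' v) = v"
proof -
  obtain i where i: "[m * i = 1] (mod int p)" using inverse_mod_exists[OF assms] .
  have i': "[i * m = 1] (mod int p)" using i by (simp add: mult.commute)
  have "\<not> int p dvd i" using i by (rule inverse_mod_not_dvd)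
  moreover have "aff i (- (i * c)) (aff m c v) = v" if "v \<in> V" for v
    using aff_cong[OF i', of 0 0] aff_id[OF that] by (simp add: aff_aff)
  moreover have "aff m c (aff i (- (i * c)) v) = v" if "v \<in> V" for v
  proof -
    have "[m * - (i * c) + c = 0] (mod int p)"
      using cong_scalar_right[OF i, of c] by (simp add: cong_iff_dvd_diff algebra_simps dvd_diff_commute)
    then show ?thesis using aff_cong[OF i] aff_id[OF that] by (simp add: aff_aff)
  qed
  ultimately show thesis using that by blast
qed

lemma inj_on_aff:
  assumes "\<not> int p dvd m"
  shows "inj_on (aff m c) V"
proof -
  obtain m' c' where "\<forall>v\<in>V. aff m' c' (aff m c v) = v" by (rule aff_inverse[OF assms])
  then show ?thesis by (auto intro: inj_on_inverseI)
qed

text \<open>\<open>aff m c\<close> respects the group operation and therefore quotients. Affine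
  images of connection sets thus give isomorphic digraphs when \<open>m\<close> is
  invertible.\<close>

lemma arrow_aff: "arrow (aff m c u) (aff m c v) = aff m c (arrow u v)"
  by (cases "snd u"; cases "snd v")
    (simp_all add: arrow_def aff_mod, simp_all add: aff_def mod_simps, simp_all add: algebra_simps)

text \<open>
  The generating sets: a set of non-identity elements fails to generate \<open>D\<^sub>2\<^sub>p\<close> iff it consists of
  rotations only or is a single reflection.
\<close>

definition connection_sets :: "(int \<times> bool) set set" where
  "connection_sets = {S. S \<subseteq> V \<and> (0, False) \<notin> S \<and> (\<exists>x. (x, True) \<in> S) \<and> (\<nexists>x. S = {(x, True)})}"

text \<open>An affine bijection fixes the identity and keeps reflections apart from rotations; by
  injectivity a single reflection arises only from a single reflection.\<close>

lemma aff_image_connection_sets: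
  assumes m: "\<not> int p dvd m" and S: "S \<in> connection_sets"
  shows "aff m c ` S \<in> connection_sets"
proof -
  have SV: "S \<subseteq> V" and S0: "(0, False) \<notin> S" and ex: "\<exists>x. (x, True) \<in> S" and ns: "\<nexists>x. S = {(x, True)}"
    using S by (auto simp: connection_sets_def)
  have inj: "inj_on (aff m c) V" using m by (rule inj_on_aff)
  have "(0, False) \<notin> aff m c ` S"
  proof
    assume "(0, False) \<in> aff m c ` S"
    then obtain v where "v \<in> S" "aff m c v = aff m c (0, False)" by (auto simp: aff_zero)
    then have "v = (0, False)" using inj SV zero_in_V by (auto dest: inj_onD)
    then show False using S0 \<open>v \<in> S\<close> by simp
  qed
  moreover obtain x where x: "(x, True) \<in> S" using ex by blast
  then have "(fst (aff m c (x, True)), True) \<in> aff m c ` S"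
    by (intro image_eqI[OF _ x]) (simp add: prod_eq_iff)
  moreover have "aff m c ` S \<noteq> {(y, True)}" for y
  proof
    assume eq: "aff m c ` S = {(y, True)}"
    have "v = (x, True)" if "v \<in> S" for v
    proof -
      have "aff m c v = (y, True)" "aff m c (x, True) = (y, True)" using eq that x by auto
      then show ?thesis using inj SV that x by (metis inj_onD subsetD)
    qed
    then show False using x ns by blast
  qed
  ultimately show ?thesis by (auto simp: connection_sets_def)
qed

section \<open>The affine action and its invariant sets\<close>

lemma not_dvd_of_range: "a \<in> {1..<int p} \<Longrightarrow> \<not> int p dvd a"
  by (auto dest: zdvd_imp_le)

text \<open>Reduced coefficients give each affine map one name, and the product is the one of
  \<open>aff_aff\<close>, so that pairs multiply as the maps compose.\<close>

definition affine_group :: "(int \<times> int) monoid" where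
  "affine_group = \<lparr>carrier = {1..<int p} \<times> {0..<int p},
     monoid.mult = (\<lambda>(a, b) (a', b'). (a * a' mod int p, (a * b' + b) mod int p)),
     one = (1, 0)\<rparr>"

lemma mod_nonzero_range: "\<not> int p dvd x \<Longrightarrow> x mod int p \<in> {1..<int p}"
proof -
  assume "\<not> int p dvd x"
  then have "x mod int p \<noteq> 0" by (simp add: dvd_eq_mod_eq_0)
  moreover have "0 \<le> x mod int p" "x mod int p < int p" using p_ge_3 by simp_all
  ultimately show ?thesis unfolding atLeastLessThan_iff by linarith
qed

lemma not_dvd_mult: "\<not> int p dvd x \<Longrightarrow> \<not> int p dvd y \<Longrightarrow> \<not> int p dvd x * y"
  using prime by (simp add: prime_dvd_mult_iff)

lemma group_affine_group: "group affine_group"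
proof (rule groupI)
  fix g h assume "g \<in> carrier affine_group" "h \<in> carrier affine_group"
  then obtain a b a' b' where gh: "g = (a, b)" "h = (a', b')" "a \<in> {1..<int p}" "a' \<in> {1..<int p}"
    by (auto simp: affine_group_def)
  then have "a * a' mod int p \<in> {1..<int p}"
    by (intro mod_nonzero_range not_dvd_mult not_dvd_of_range)
  then show "g \<otimes>\<^bsub>affine_group\<^esub> h \<in> carrier affine_group"
    using gh p_ge_3 by (simp add: affine_group_def)
next
  show "\<one>\<^bsub>affine_group\<^esub> \<in> carrier affine_group" using p_ge_3 by (simp add: affine_group_def)
next
  fix x y z assume "x \<in> carrier affine_group" "y \<in> carrier affine_group" "z \<in> carrier affine_group"
  obtain a b a' b' a'' b'' where xyz: "x = (a, b)" "y = (a', b')" "z = (a'', b'')"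
    by (cases x; cases y; cases z)
  have "[a * a' mod int p * b'' + (a * b' + b) mod int p = a * a' * b'' + (a * b' + b)] (mod int p)"
    by (intro cong_add cong_mult) (auto simp: cong_def)
  moreover have "[a * ((a' * b'' + b') mod int p) + b = a * (a' * b'' + b') + b] (mod int p)"
    by (intro cong_add cong_mult) (auto simp: cong_def)
  ultimately have "(a * a' mod int p * b'' + (a * b' + b) mod int p) mod int p =
      (a * ((a' * b'' + b') mod int p) + b) mod int p"
    by (simp add: cong_def algebra_simps)
  then show "x \<otimes>\<^bsub>affine_group\<^esub> y \<otimes>\<^bsub>affine_group\<^esub> z = x \<otimes>\<^bsub>affine_group\<^esub> (y \<otimes>\<^bsub>affine_group\<^esub> z)"
    by (simp add: affine_group_def xyz mod_simps mult.assoc)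
next
  fix x assume "x \<in> carrier affine_group"
  then show "\<one>\<^bsub>affine_group\<^esub> \<otimes>\<^bsub>affine_group\<^esub> x = x" by (auto simp: affine_group_def)
next
  fix x assume "x \<in> carrier affine_group"
  then obtain a b where x: "x = (a, b)" "a \<in> {1..<int p}" by (auto simp: affine_group_def)
  obtain i where i: "[a * i = 1] (mod int p)" using inverse_mod_exists[OF not_dvd_of_range[OF x(2)]] .
  have ndvd: "\<not> int p dvd i" using i by (rule inverse_mod_not_dvd)
  let ?y = "(i mod int p, (- (i * b)) mod int p)"
  have "[i mod int p * b + (- (i * b)) mod int p = i * b + - (i * b)] (mod int p)"
    by (intro cong_add cong_mult) (auto simp: cong_def)
  then have "?y \<otimes>\<^bsub>affine_group\<^esub> x = \<one>\<^bsub>affine_group\<^esub>"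
    using i p_ge_3 by (simp add: affine_group_def x mod_simps cong_def mult.commute)
  moreover have "?y \<in> carrier affine_group"
    using mod_nonzero_range[OF ndvd] p_ge_3 by (simp add: affine_group_def)
  ultimately show "\<exists>y\<in>carrier affine_group. y \<otimes>\<^bsub>affine_group\<^esub> x = \<one>\<^bsub>affine_group\<^esub>" by blast
qed

text \<open>The function is restricted to \<open>connection_sets\<close> because the members of
  \<open>Bij\<close> must be extensional.\<close>

definition affine_action :: "int \<times> int \<Rightarrow> (int \<times> bool) set \<Rightarrow> (int \<times> bool) set" where
  "affine_action = (\<lambda>(a, b). \<lambda>S\<in>connection_sets. aff a b ` S)"

lemma affine_action_Bij:
  assumes "g \<in> carrier affine_group"
  shows "affine_action g \<in> Bij connection_sets"
proof -
  obtain a b where g: "g = (a, b)" "a \<in> {1..<int p}" using assms by (auto simp: affine_group_def)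
  note nd = not_dvd_of_range[OF g(2)]
  obtain m c where mc: "\<not> int p dvd m" "\<forall>v\<in>V. aff m c (aff a b v) = v" "\<forall>v\<in>V. aff a b (aff m c v) = v"
    by (rule aff_inverse[OF nd, of b])
  have cancel: "h ` f ` S = S" if "S \<in> connection_sets" "\<forall>v\<in>V. h (f v) = v" for S and f h :: "int \<times> bool \<Rightarrow> int \<times> bool"
  proof -
    have "S \<subseteq> V" using that(1) by (simp add: connection_sets_def)
    then have "(\<lambda>v. h (f v)) ` S = (\<lambda>v. v) ` S" using that(2) by (intro image_cong) auto
    then show ?thesis by (simp add: image_image)
  qed
  have "bij_betw (\<lambda>S. aff a b ` S) connection_sets connection_sets"
  proof (rule bij_betw_byWitness[where f' = "\<lambda>S. aff m c ` S"])
    show "\<forall>S\<in>connection_sets. aff m c ` aff a b ` S = S"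
      using cancel mc(2) by blast
    show "\<forall>S\<in>connection_sets. aff a b ` aff m c ` S = S"
      using cancel mc(3) by blast
  qed (use aff_image_connection_sets nd mc(1) in auto)
  then have "bij_betw (affine_action g) connection_sets connection_sets"
    by (rule bij_betw_cong[THEN iffD1, rotated]) (simp add: affine_action_def g)
  then show ?thesis by (simp add: Bij_def affine_action_def g)
qed

lemma group_action_affine: "group_action affine_group connection_sets affine_action"
proof -
  have "affine_action (g \<otimes>\<^bsub>affine_group\<^esub> h) = affine_action g \<otimes>\<^bsub>BijGroup connection_sets\<^esub> affine_action h"
    if gh: "g \<in> carrier affine_group" "h \<in> carrier affine_group" for g h
  proof -
    obtain a b a' b' where eq: "g = (a, b)" "h = (a', b')" by (cases g; cases h)
    have nd: "\<not> int p dvd a'" using gh(2) not_dvd_of_range by (auto simp: affine_group_def eq)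
    have comp: "aff (a * a' mod int p) ((a * b' + b) mod int p) v = aff a b (aff a' b' v)" for v
      unfolding aff_aff by (intro fun_cong[OF aff_cong]) (auto simp: cong_def)
    have "affine_action (g \<otimes>\<^bsub>affine_group\<^esub> h) = compose connection_sets (affine_action g) (affine_action h)"
    proof
      fix S
      show "affine_action (g \<otimes>\<^bsub>affine_group\<^esub> h) S = compose connection_sets (affine_action g) (affine_action h) S"
        using aff_image_connection_sets[OF nd]
        by (cases "S \<in> connection_sets")
          (auto simp: affine_action_def affine_group_def eq compose_def comp image_image)
    qed
    then show ?thesis using affine_action_Bij gh by (simp add: BijGroup_def)
  qed
  then have "affine_action \<in> hom affine_group (BijGroup connection_sets)"
    using affine_action_Bij by (auto simp: hom_def BijGroup_def)
  then show ?thesis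
    using group_affine_group group_BijGroup
    by (simp add: group_action_def group_hom_def group_hom_axioms_def)
qed

lemma ex_affine_iff:
  "(\<exists>m c. \<not> int p dvd m \<and> T = aff m c ` S) \<longleftrightarrow> (\<exists>a b. (a, b) \<in> carrier affine_group \<and> T = aff a b ` S)"
proof
  assume "\<exists>m c. \<not> int p dvd m \<and> T = aff m c ` S"
  then obtain m c where mc: "\<not> int p dvd m" "T = aff m c ` S" by blast
  have "aff m c = aff (m mod int p) (c mod int p)" by (intro aff_cong) (auto simp: cong_def)
  moreover have "(m mod int p, c mod int p) \<in> carrier affine_group"
    using mod_nonzero_range[OF mc(1)] p_ge_3 by (simp add: affine_group_def)
  ultimately show "\<exists>a b. (a, b) \<in> carrier affine_group \<and> T = aff a b ` S" using mc(2) by metis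
qed (use not_dvd_of_range in \<open>auto simp: affine_group_def\<close>)

section \<open>Sets invariant under an affine map\<close>

text \<open>Measured from a fixed point \<open>x0\<close>, the affine map is multiplication by
  \<open>a\<close>.\<close>

lemma aff_funpow:
  assumes fx: "[a * x0 + (if s then b else 0) = x0] (mod int p)"
  shows "(aff a b ^^ k) ((x0 + y) mod int p, s) = ((x0 + a ^ k * y) mod int p, s)"
proof (induction k)
  case (Suc k)
  have "[a * (x0 + a ^ k * y) + (if s then b else 0) = (a * x0 + (if s then b else 0)) + a ^ Suc k * y] (mod int p)"
    by (simp add: algebra_simps)
  also have "[(a * x0 + (if s then b else 0)) + a ^ Suc k * y = x0 + a ^ Suc k * y] (mod int p)"
    by (rule cong_add[OF fx cong_refl])
  finally have "aff a b (x0 + a ^ k * y, s) = ((x0 + a ^ Suc k * y) mod int p, s)"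
    by (simp add: aff_def cong_def)
  then show ?case by (simp add: Suc aff_mod)
qed simp

text \<open>A nonzero displacement from the fixed point returns after \<open>k\<close> steps iff
  \<open>a ^ k\<close> is \<open>1\<close> mod \<open>p\<close>. So all orbits on the other
  \<open>p - 1\<close> points have length \<open>ord p (nat a)\<close>.\<close>

lemma card_invariant_subsets_side:
  assumes a: "a \<in> {1..<int p}" and fx: "[a * x0 + (if s then b else 0) = x0] (mod int p)"
  shows "card {S. S \<subseteq> side s - {(x0 mod int p, s)} \<and> aff a b ` S = S} = 2 ^ ((p - 1) div ord p (nat a))"
proof -
  let ?X = "side s - {(x0 mod int p, s)}"
  have cop: "coprime p (nat a)"
    using a prime by (intro prime_imp_coprime) (auto dest: dvd_imp_le)
  have pow1: "[a ^ k = 1] (mod int p) \<longleftrightarrow> ord p (nat a) dvd k" for k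
  proof -
    have "[a ^ k = 1] (mod int p) \<longleftrightarrow> [nat a ^ k = 1] (mod p)"
      using a by (simp flip: cong_int_iff)
    then show ?thesis by (simp only: ord_divides)
  qed
  have repr: "\<exists>y. v = ((x0 + y) mod int p, s) \<and> \<not> int p dvd y" if "v \<in> ?X" for v
  proof (intro exI conjI)
    have v: "v = (fst v, s)" "fst v mod int p = fst v" using that by (auto simp: side_def)
    then show "v = ((x0 + (fst v - x0)) mod int p, s)" by simp
    show "\<not> int p dvd fst v - x0"
    proof
      assume "int p dvd fst v - x0"
      then have "fst v mod int p = x0 mod int p" by (simp add: mod_eq_dvd_iff)
      then show False using that v by auto
    qed
  qed
  have iter: "(aff a b ^^ k) ((x0 + y) mod int p, s) = ((x0 + y) mod int p, s) \<longleftrightarrow> ord p (nat a) dvd k"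
    if y: "\<not> int p dvd y" for y k
  proof -
    have "(aff a b ^^ k) ((x0 + y) mod int p, s) = ((x0 + y) mod int p, s) \<longleftrightarrow> int p dvd (a ^ k - 1) * y"
      unfolding aff_funpow[OF fx] by (simp add: mod_eq_dvd_iff algebra_simps)
    also have "\<dots> \<longleftrightarrow> [a ^ k = 1] (mod int p)"
      using y prime by (simp add: prime_dvd_mult_iff cong_iff_dvd_diff)
    finally show ?thesis by (simp only: pow1)
  qed
  have "card ?X = p - 1"
    by (subst card_Diff_singleton) (simp_all add: side_iff card_side)
  moreover have "card {S. S \<subseteq> ?X \<and> aff a b ` S = S} = 2 ^ (card ?X div ord p (nat a))"
  proof (rule card_invariant_subsets)
    show "finite ?X" by (simp add: finite_side)
    show "ord p (nat a) > 0" using cop by simp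
    show "(aff a b ^^ ord p (nat a)) v = v" if "v \<in> ?X" for v
      using repr[OF that] iter by auto
    show "(aff a b ^^ k) v \<noteq> v" if "v \<in> ?X" "0 < k" "k < ord p (nat a)" for v k
      using repr[OF that(1)] iter nat_dvd_not_less[OF that(2,3)] by auto
    show "aff a b v \<in> ?X" if "v \<in> ?X" for v
    proof -
      obtain y where y: "v = ((x0 + y) mod int p, s)" "\<not> int p dvd y" using repr[OF \<open>v \<in> ?X\<close>] by blast
      have "aff a b v = ((x0 + a * y) mod int p, s)" using aff_funpow[OF fx, of 1 y] y by simp
      moreover have "(x0 + a * y) mod int p \<noteq> x0 mod int p"
        using not_dvd_mult[OF not_dvd_of_range[OF a] y(2)] by (simp add: mod_eq_dvd_iff)
      ultimately show ?thesis by (simp add: side_iff)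
    qed
  qed
  ultimately show ?thesis by simp
qed

text \<open>The multipliers are sorted by their order \<open>d\<close>; the units mod
  \<open>p\<close> form a cyclic group of order \<open>p - 1\<close>, which has
  \<open>totient d\<close> elements of order \<open>d\<close>.\<close>

lemma sum_ord_eq_sum_totient:
  fixes h :: "nat \<Rightarrow> real"
  shows "(\<Sum>a\<in>{1..<int p}. h (ord p (nat a))) = (\<Sum>d | d dvd p - 1. real (totient d) * h d)"
proof -
  have "(\<Sum>a\<in>{1..<int p}. h (ord p (nat a))) = (\<Sum>x\<in>totatives p. h (ord p x))"
    by (rule sum.reindex_bij_witness[of _ int nat]) (auto simp: totatives_prime[OF prime])
  also have "\<dots> = (\<Sum>d | d dvd p - 1. \<Sum>x | x \<in> totatives p \<and> ord p x = d. h (ord p x))"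
  proof (rule sum.group[symmetric])
    show "finite {d. d dvd p - 1}" using p_ge_3 by simp
    show "ord p ` totatives p \<subseteq> {d. d dvd p - 1}"
      using order_divides_totient[of p] totient_prime[OF prime]
      by (auto simp: totatives_def coprime_commute)
  qed simp
  also have "\<dots> = (\<Sum>d | d dvd p - 1. real (totient d) * h d)"
  proof (rule sum.cong[OF refl])
    fix d assume "d \<in> {d. d dvd p - 1}"
    then have "card {x \<in> totatives p. ord p x = d} = totient d"
      using prime_card_elements_with_ord_eq_totient[of p d] prime p_ge_3 by simp
    moreover have "(\<Sum>x | x \<in> totatives p \<and> ord p x = d. h (ord p x)) =
        (\<Sum>x | x \<in> totatives p \<and> ord p x = d. h d)" by (rule sum.cong) auto
    ultimately show "(\<Sum>x | x \<in> totatives p \<and> ord p x = d. h (ord p x)) = real (totient d) * h d"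
      by simp
  qed
  finally show ?thesis .
qed

text \<open>The number of orbits of multiplication by \<open>a\<close> on the nonzero
  residues.\<close>

definition cycles :: "int \<Rightarrow> nat" where
  "cycles a = (p - 1) div ord p (nat a)"

lemma card_invariant_rotations:
  assumes "a \<in> {1..<int p}"
  shows "card {S. S \<subseteq> side False - {(0, False)} \<and> aff a b ` S = S} = 2 ^ cycles a"
  using card_invariant_subsets_side[of a 0 False b] assms by (simp add: cycles_def)

text \<open>A nontrivial translation is a single \<open>p\<close>-cycle, so only the empty and the
  full set are invariant. Any other affine map has a fixed reflection, which can be put in or left
  out freely: a factor \<open>2\<close>.\<close>

lemma card_invariant_reflections:
  assumes a: "a \<in> {1..<int p}" and b: "b \<in> {0..<int p}"
  shows "card {S. S \<subseteq> side True \<and> aff a b ` S = S} = (if a = 1 \<and> b \<noteq> 0 then 2 else 2 * 2 ^ cycles a)"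
proof (cases "a = 1 \<and> b \<noteq> 0")
  case True
  have iter: "(aff 1 b ^^ k) (x mod int p, True) = ((x + int k * b) mod int p, True)" for k x
  proof (induction k)
    case (Suc k)
    then show ?case by (simp add: aff_mod) (simp add: aff_def algebra_simps)
  qed simp
  have "card {S. S \<subseteq> side True \<and> aff 1 b ` S = S} = 2 ^ (card (side True) div p)"
  proof (rule card_invariant_subsets)
    have *: "(aff 1 b ^^ k) v = ((fst v + int k * b) mod int p, True)" "v = (fst v, True)" "fst v mod int p = fst v"
      if "v \<in> side True" for k v
    proof -
      show v: "v = (fst v, True)" "fst v mod int p = fst v" using that by (auto simp: side_def)
      show "(aff 1 b ^^ k) v = ((fst v + int k * b) mod int p, True)" using iter[of k "fst v"] v by simp
    qed
    show "(aff 1 b ^^ p) v = v" if "v \<in> side True" for v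
      using *(1)[OF that, of p] *(2,3)[OF that] by simp
    show "(aff 1 b ^^ k) v \<noteq> v" if v: "v \<in> side True" and k: "0 < k" "k < p" for v k
    proof
      assume "(aff 1 b ^^ k) v = v"
      then have "(fst v + int k * b) mod int p = fst v mod int p" using *(1)[OF v, of k] *(3)[OF v] by (metis fst_conv)
      then have "int p dvd int k * b" by (simp add: mod_eq_dvd_iff)
      moreover have "\<not> int p dvd int k" "\<not> int p dvd b"
        using k b True not_dvd_of_range[of "int k"] not_dvd_of_range[of b] by auto
      ultimately show False using not_dvd_mult by blast
    qed
    show "aff 1 b v \<in> side True" if "v \<in> side True" for v using that by (simp add: side_iff)
  qed (use p_ge_3 finite_side in auto)
  then show ?thesis using True p_ge_3 by (simp add: card_side)
next
  case False
  \<comment> \<open>The equation \<open>(a - 1) * x = - b\<close> is solved by inverting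
    \<open>a - 1\<close>; when \<open>a = 1\<close>, also \<open>b = 0\<close> and any point will
    do.\<close>
  have "\<exists>x. [a * x + b = x] (mod int p)"
  proof (cases "a = 1")
    case True
    then show ?thesis using False by (intro exI[of _ 0]) simp
  next
    case a1: False
    have "\<not> int p dvd a - 1" using a a1 not_dvd_of_range[of "a - 1"] by auto
    then obtain i where i: "[(a - 1) * i = 1] (mod int p)" by (rule inverse_mod_exists)
    have "int p dvd b * (1 - (a - 1) * i)"
      using i by (simp add: cong_iff_dvd_diff dvd_diff_commute)
    then show ?thesis
      by (intro exI[of _ "- (b * i)"]) (simp add: cong_iff_dvd_diff algebra_simps)
  qed
  then obtain x0 where x0: "[a * x0 + (if True then b else 0) = x0] (mod int p)" by auto
  define q where "q = (x0 mod int p, True)"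
  have q: "aff a b q = q" using x0 by (simp add: q_def aff_mod) (simp add: aff_def cong_def)
  have qs: "q \<in> side True" by (simp add: q_def side_iff)
  have rest: "aff a b ` (side True - {q}) \<subseteq> side True - {q}"
  proof (rule image_subsetI)
    fix v assume v: "v \<in> side True - {q}"
    have "aff a b v \<noteq> q"
    proof
      assume "aff a b v = q"
      then have eq: "aff a b v = aff a b q" using q by simp
      have "v \<in> V" "q \<in> V" using v qs by (auto simp: side_iff)
      then have "v = q" using inj_onD[OF inj_on_aff[OF not_dvd_of_range[OF a]] eq] by blast
      then show False using v by simp
    qed
    then show "aff a b v \<in> side True - {q}" using v by (simp add: side_iff)
  qed
  have "{S. S \<subseteq> {q} \<and> aff a b ` S = S} = {{}, {q}}"
    using q by (auto simp: subset_singleton_iff)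
  then have two: "card {S. S \<subseteq> {q} \<and> aff a b ` S = S} = 2" by simp
  have "{q} \<union> (side True - {q}) = side True" using qs by blast
  then have "card {S. S \<subseteq> side True \<and> aff a b ` S = S} = 2 * 2 ^ cycles a"
    using card_invariant_subsets_Un[of "{q}" "side True - {q}" "aff a b"] rest q two
      card_invariant_subsets_side[OF a x0] by (simp add: finite_side cycles_def q_def)
  then show ?thesis using False by auto
qed

text \<open>The right side counts all invariant sets without the identity as pairs of rotation part
  and reflection part. They fall into connection sets, sets of rotations and single fixed
  reflections. The additive form avoids truncated subtraction.\<close>

lemma card_invariants_affine_action:
  assumes a: "a \<in> {1..<int p}" and b: "b \<in> {0..<int p}"
  shows "card (invariants connection_sets affine_action (a, b)) + 2 ^ cycles a
      + card {x \<in> {0..<int p}. (a * x + b) mod int p = x}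
    = 2 ^ cycles a * (if a = 1 \<and> b \<noteq> 0 then 2 else 2 * 2 ^ cycles a)"
proof -
  let ?A = "side False - {(0, False)}"
  let ?inv = "\<lambda>X. {S. S \<subseteq> X \<and> aff a b ` S = S}"
  let ?fix = "{x \<in> {0..<int p}. (a * x + b) mod int p = x}"
  let ?E = "invariants connection_sets affine_action (a, b)"
  let ?single = "(\<lambda>x. {(x, True)}) ` ?fix"
  have E: "?E = {S \<in> connection_sets. aff a b ` S = S}"
    by (auto simp: invariants_def affine_action_def)
  have V: "v \<in> V \<longleftrightarrow> v \<in> side False \<or> v \<in> side True" for v by (auto simp: side_iff)
  have eq: "?inv (?A \<union> side True) = ?E \<union> ?inv ?A \<union> ?single"
  proof (intro equalityI subsetI)
    fix S assume S: "S \<in> ?inv (?A \<union> side True)"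
    then have SV: "S \<subseteq> V" and S0: "(0, False) \<notin> S" using V by (blast, auto simp: side_def)
    consider "\<nexists>x. (x, True) \<in> S" | x where "S = {(x, True)}" | "\<exists>x. (x, True) \<in> S" "\<nexists>x. S = {(x, True)}"
      by blast
    then show "S \<in> ?E \<union> ?inv ?A \<union> ?single"
    proof cases
      case 1
      then have "S \<subseteq> ?A" using S by (auto simp: side_def)
      then show ?thesis using S by simp
    next
      case 2
      then have "aff a b (x, True) = (x, True)" using S by auto
      moreover have "x \<in> {0..<int p}" using SV 2 by (auto simp: V_def)
      ultimately have "x \<in> ?fix" by (simp add: aff_def)
      then show ?thesis using 2 by blast
    next
      case 3
      then have "S \<in> connection_sets" unfolding connection_sets_def using SV S0 by blast
      moreover have "aff a b ` S = S" using S by simp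
      ultimately have "S \<in> ?E" unfolding E by simp
      then show ?thesis by simp
    qed
  next
    fix S assume "S \<in> ?E \<union> ?inv ?A \<union> ?single"
    then consider "S \<in> ?E" | "S \<in> ?inv ?A" | "S \<in> ?single" by blast
    then show "S \<in> ?inv (?A \<union> side True)"
    proof cases
      case 1
      then have S: "S \<in> connection_sets" "aff a b ` S = S" unfolding E by simp_all
      then have "S \<subseteq> V" "(0, False) \<notin> S" by (simp_all add: connection_sets_def)
      then have "S \<subseteq> ?A \<union> side True" using V by blast
      then show ?thesis using S(2) by simp
    next
      case 3
      then show ?thesis by (auto simp: side_def aff_def)
    qed auto
  qed
  have fin: "finite (?inv (?A \<union> side True))"
    by (rule finite_subset[of _ "Pow (?A \<union> side True)"]) (auto simp: finite_side)
  have disj: "?E \<inter> ?inv ?A = {}" "(?E \<union> ?inv ?A) \<inter> ?single = {}"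
  proof -
    have n1: "\<not> S \<subseteq> ?A" if S: "S \<in> ?E" for S
    proof -
      obtain x where "(x, True) \<in> S" using S unfolding E unfolding connection_sets_def by blast
      then show ?thesis by (auto simp: side_iff)
    qed
    have n2: "{(x, True)} \<notin> ?E" for x unfolding E unfolding connection_sets_def by blast
    have n3: "\<not> {(x, True)} \<subseteq> ?A" for x by (simp add: side_iff)
    show "?E \<inter> ?inv ?A = {}" using n1 by blast
    show "(?E \<union> ?inv ?A) \<inter> ?single = {}"
    proof (rule equals0I)
      fix S assume S: "S \<in> (?E \<union> ?inv ?A) \<inter> ?single"
      then obtain x where x: "S = {(x, True)}" by (elim IntE imageE)
      have "S \<in> ?E \<or> S \<subseteq> ?A" using S by blast
      then show False unfolding x using n2[of x] n3[of x] by blast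
    qed
  qed
  have "finite ?E" "finite (?inv ?A)" "finite ?single" using fin unfolding eq by simp_all
  then have "card (?E \<union> ?inv ?A \<union> ?single) = card ?E + card (?inv ?A) + card ?single"
    using disj by (simp only: card_Un_disjoint finite_UnI)
  then have "card (?inv (?A \<union> side True)) = card ?E + card (?inv ?A) + card ?single"
    by (simp only: eq)
  moreover have "card ?single = card ?fix" by (rule card_image) (auto simp: inj_on_def)
  moreover have "card (?inv (?A \<union> side True)) = card (?inv ?A) * card (?inv (side True))"
  proof (rule card_invariant_subsets_Un)
    show "aff a b ` ?A \<subseteq> ?A"
    proof (rule image_subsetI)
      fix v assume v: "v \<in> ?A"
      then have "v \<in> V" "v \<noteq> (0, False)" by (auto simp: side_iff)
      then have "aff a b v \<noteq> aff a b (0, False)"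
        using inj_onD[OF inj_on_aff[OF not_dvd_of_range[OF a], of b], of v "(0, False)"] zero_in_V by blast
      then show "aff a b v \<in> ?A" using v by (simp add: side_iff aff_zero)
    qed
    show "aff a b ` side True \<subseteq> side True" by (auto simp: side_iff)
  qed (auto simp: finite_side side_iff)
  ultimately show ?thesis
    using card_invariant_rotations[OF a, of b] card_invariant_reflections[OF a b] by simp
qed

section \<open>The Burnside count\<close>

text \<open>Double counting: for given \<open>a\<close>, each reflection \<open>x\<close> is fixed
  for exactly one translation part, the residue of \<open>x - a * x\<close>.\<close>

lemma sum_card_fixed_reflections:
  "(\<Sum>b\<in>{0..<int p}. card {x \<in> {0..<int p}. (a * x + b) mod int p = x}) = p"
proof -
  have one: "{b \<in> {0..<int p}. (a * x + b) mod int p = x} = {(x - a * x) mod int p}"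
    if x: "x \<in> {0..<int p}" for x
  proof (intro equalityI subsetI)
    fix b assume "b \<in> {b \<in> {0..<int p}. (a * x + b) mod int p = x}"
    then have b: "b mod int p = b" "(a * x + b) mod int p = x mod int p" using x by auto
    then have "int p dvd a * x + b - x" by (simp add: mod_eq_dvd_iff)
    then have "b mod int p = (x - a * x) mod int p" by (simp add: mod_eq_dvd_iff algebra_simps)
    then show "b \<in> {(x - a * x) mod int p}" using b by simp
  next
    fix b assume "b \<in> {(x - a * x) mod int p}"
    then show "b \<in> {b \<in> {0..<int p}. (a * x + b) mod int p = x}"
      using x p_ge_3 by (simp add: mod_simps)
  qed
  have "(\<Sum>b\<in>{0..<int p}. card {x \<in> {0..<int p}. (a * x + b) mod int p = x}) =
      (\<Sum>b\<in>{0..<int p}. \<Sum>x\<in>{0..<int p}. if (a * x + b) mod int p = x then 1 else 0)"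
    by (intro sum.cong card_as_sums) auto
  also have "\<dots> = (\<Sum>x\<in>{0..<int p}. \<Sum>b\<in>{0..<int p}. if (a * x + b) mod int p = x then 1 else 0)"
    by (rule sum.swap)
  also have "\<dots> = (\<Sum>x\<in>{0..<int p}. card {b \<in> {0..<int p}. (a * x + b) mod int p = x})"
    by (intro sum.cong card_as_sums[symmetric]) auto
  also have "\<dots> = (\<Sum>x\<in>{0..<int p}. 1)"
  proof (rule sum.cong[OF refl])
    fix x assume "x \<in> {0..<int p}"
    then show "card {b \<in> {0..<int p}. (a * x + b) mod int p = x} = 1" by (simp only: one) simp
  qed
  finally show ?thesis by simp
qed

lemma finite_connection_sets: "finite connection_sets"
  by (rule finite_subset[of _ "Pow V"]) (auto simp: connection_sets_def finite_V)

lemma card_orbits_affine_action: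
  "real (card (orbits affine_group connection_sets affine_action)) = N_all p - N_c p - 1"
proof -
  let ?D = "\<lambda>h. \<Sum>d | d dvd p - 1. real (totient d) * h d"
  interpret group_action affine_group connection_sets affine_action by (rule group_action_affine)
  have carr: "carrier affine_group = {1..<int p} \<times> {0..<int p}" by (simp add: affine_group_def)
  have "card (orbits affine_group connection_sets affine_action) * order affine_group =
      (\<Sum>g\<in>carrier affine_group. card (invariants connection_sets affine_action g))"
    by (rule burnside) (auto simp: carr finite_connection_sets)
  moreover have "order affine_group = (p - 1) * p"
    using p_ge_3 by (simp add: order_def carr card_cartesian_product nat_diff_distrib)
  ultimately have "card (orbits affine_group connection_sets affine_action) * ((p - 1) * p) =
      (\<Sum>a\<in>{1..<int p}. \<Sum>b\<in>{0..<int p}. card (invariants connection_sets affine_action (a, b)))"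
    by (simp add: carr sum.cartesian_product)
  from arg_cong[OF this, of real]
  have "real (card (orbits affine_group connection_sets affine_action)) * ((real p - 1) * real p) =
      (\<Sum>a\<in>{1..<int p}. \<Sum>b\<in>{0..<int p}. real (card (invariants connection_sets affine_action (a, b))))"
    using p_ge_3 by (simp add: of_nat_diff)
  \<comment> \<open>The generic count is used for every \<open>b\<close>, then corrected at
    \<open>a = 1\<close>: each of the \<open>p - 1\<close> nontrivial translations contributes
    \<open>2 ^ p\<close> where the generic term is \<open>2 ^ (2 * p - 1)\<close>, because
    \<open>cycles 1 = p - 1\<close>.\<close>
  also have "\<dots> = (\<Sum>a\<in>{1..<int p}. real p * (2 * 2 ^ (2 * cycles a) - 2 ^ cycles a - 1)
      - (if a = 1 then (real p - 1) * (2 ^ (2 * p - 1) - 2 ^ p) else 0))"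
  proof (rule sum.cong[OF refl])
    fix a assume a: "a \<in> {1..<int p}"
    have c1: "cycles 1 = p - 1" by (simp add: cycles_def)
    have "(\<Sum>b\<in>{0..<int p}. real (card (invariants connection_sets affine_action (a, b)))) =
        (\<Sum>b\<in>{0..<int p}. 2 * 2 ^ (2 * cycles a) - 2 ^ cycles a
          - real (card {x \<in> {0..<int p}. (a * x + b) mod int p = x})
          - (if a = 1 \<and> b \<noteq> 0 then 2 ^ (2 * p - 1) - 2 ^ p else 0))"
    proof (rule sum.cong[OF refl])
      fix b assume b: "b \<in> {0..<int p}"
      have "real (card (invariants connection_sets affine_action (a, b))) + 2 ^ cycles a
          + real (card {x \<in> {0..<int p}. (a * x + b) mod int p = x})
        = 2 ^ cycles a * (if a = 1 \<and> b \<noteq> 0 then 2 else 2 * 2 ^ cycles a)"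
        using arg_cong[OF card_invariants_affine_action[OF a b], of real] by (simp split: if_splits)
      moreover have "2 ^ cycles a * (if a = 1 \<and> b \<noteq> 0 then 2 else 2 * 2 ^ cycles a) =
          2 * 2 ^ (2 * cycles a) - (if a = 1 \<and> b \<noteq> 0 then 2 ^ (2 * p - 1) - 2 ^ p else (0 :: real))"
      proof -
        have "2 * p - 1 = 1 + (p - 1) + (p - 1)" using p_ge_3 by simp
        then have e1: "(2 :: real) ^ (2 * p - 1) = 2 * 2 ^ (p - 1) * 2 ^ (p - 1)"
          by (simp only: power_add power_one_right)
        have e2: "(2 :: real) ^ p = 2 * 2 ^ (p - 1)" using p_ge_3 by (simp add: power_eq_if)
        have e3: "(2 :: real) ^ (2 * cycles a) = 2 ^ cycles a * 2 ^ cycles a"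
          by (simp only: mult_2 power_add)
        show ?thesis unfolding e1 e2 e3 by (auto simp: c1)
      qed
      ultimately show "real (card (invariants connection_sets affine_action (a, b))) =
          2 * 2 ^ (2 * cycles a) - 2 ^ cycles a
          - real (card {x \<in> {0..<int p}. (a * x + b) mod int p = x})
          - (if a = 1 \<and> b \<noteq> 0 then 2 ^ (2 * p - 1) - 2 ^ p else 0)"
        by linarith
    qed
    also have "\<dots> = real p * (2 * 2 ^ (2 * cycles a) - 2 ^ cycles a) - real p
        - (\<Sum>b\<in>{0..<int p}. if a = 1 \<and> b \<noteq> 0 then 2 ^ (2 * p - 1) - 2 ^ p else 0)"
      using arg_cong[OF sum_card_fixed_reflections[of a], of real] by (simp add: sum_subtractf)
    also have "(\<Sum>b\<in>{0..<int p}. if a = 1 \<and> b \<noteq> 0 then 2 ^ (2 * p - 1) - 2 ^ p else 0) =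
        (if a = 1 then (real p - 1) * (2 ^ (2 * p - 1) - 2 ^ p) else 0)"
    proof (cases "a = 1")
      case True
      have "(\<Sum>b\<in>{0..<int p}. if b \<noteq> 0 then 2 ^ (2 * p - 1) - 2 ^ p else 0) =
          (\<Sum>b\<in>{1..<int p}. 2 ^ (2 * p - 1) - 2 ^ p :: real)"
        by (rule sum.mono_neutral_cong_right) auto
      then show ?thesis using True p_ge_3 by (simp add: of_nat_diff nat_diff_distrib)
    qed simp
    finally show "(\<Sum>b\<in>{0..<int p}. real (card (invariants connection_sets affine_action (a, b)))) =
        real p * (2 * 2 ^ (2 * cycles a) - 2 ^ cycles a - 1)
      - (if a = 1 then (real p - 1) * (2 ^ (2 * p - 1) - 2 ^ p) else 0)"
      by (simp add: algebra_simps)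
  qed
  also have "\<dots> = real p * (2 * (\<Sum>a\<in>{1..<int p}. 2 ^ (2 * cycles a)) - (\<Sum>a\<in>{1..<int p}. 2 ^ cycles a) - (real p - 1))
      - (real p - 1) * (2 ^ (2 * p - 1) - 2 ^ p)"
  proof -
    have "(\<Sum>a\<in>{1..<int p}. if a = 1 then (real p - 1) * (2 ^ (2 * p - 1) - 2 ^ p) else 0) =
        (real p - 1) * (2 ^ (2 * p - 1) - 2 ^ p)"
      using p_ge_3 by simp
    moreover have "(\<Sum>a\<in>{1..<int p}. real p * (2 * 2 ^ (2 * cycles a) - 2 ^ cycles a - 1)) =
        real p * (2 * (\<Sum>a\<in>{1..<int p}. 2 ^ (2 * cycles a)) - (\<Sum>a\<in>{1..<int p}. 2 ^ cycles a) - (real p - 1))"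
      using p_ge_3 by (simp add: sum_subtractf of_nat_diff nat_diff_distrib flip: sum_distrib_left)
    ultimately show ?thesis by (simp add: sum_subtractf)
  qed
  also have "(\<Sum>a\<in>{1..<int p}. (2 :: real) ^ (2 * cycles a)) = ?D (\<lambda>d. 2 ^ (2 * (p - 1) div d))"
  proof -
    have "(\<Sum>a\<in>{1..<int p}. (2 :: real) ^ (2 * cycles a)) = ?D (\<lambda>d. 2 ^ (2 * ((p - 1) div d)))"
      using sum_ord_eq_sum_totient[of "\<lambda>d. 2 ^ (2 * ((p - 1) div d))"] by (simp add: cycles_def)
    \<comment> \<open>The factor \<open>2\<close> moves inside the integer division because
      \<open>d\<close> divides \<open>p - 1\<close>.\<close>
    also have "\<dots> = ?D (\<lambda>d. 2 ^ (2 * (p - 1) div d))"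
      by (intro sum.cong refl) (simp add: div_mult_swap)
    finally show ?thesis .
  qed
  also have "(\<Sum>a\<in>{1..<int p}. (2 :: real) ^ cycles a) = ?D (\<lambda>d. 2 ^ ((p - 1) div d))"
    using sum_ord_eq_sum_totient[of "\<lambda>d. 2 ^ ((p - 1) div d)"] by (simp add: cycles_def)
  finally have main: "real (card (orbits affine_group connection_sets affine_action)) * ((real p - 1) * real p) =
      real p * (2 * ?D (\<lambda>d. 2 ^ (2 * (p - 1) div d)) - ?D (\<lambda>d. 2 ^ ((p - 1) div d)) - (real p - 1))
      - (real p - 1) * (2 ^ (2 * p - 1) - 2 ^ p)" .
  have pow: "(2 :: real) ^ (2 * p - 1) = 2 ^ p * 2 ^ (p - 1)"
  proof -
    have "2 * p - 1 = p + (p - 1)" using p_ge_3 by simp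
    then show ?thesis by (simp add: power_add)
  qed
  have nz: "real p \<noteq> 0" "real p - 1 \<noteq> 0" using p_ge_3 by auto
  have "(N_all p - N_c p - 1) * ((real p - 1) * real p) =
      real p * (2 * ?D (\<lambda>d. 2 ^ (2 * (p - 1) div d)) - ?D (\<lambda>d. 2 ^ ((p - 1) div d)) - (real p - 1))
      - (real p - 1) * (2 ^ (2 * p - 1) - 2 ^ p)"
  proof -
    \<comment> \<open>Free variables stand for \<open>p\<close>, \<open>p - 1\<close>, the two
      powers of \<open>2\<close> and the two divisor sums, leaving a plain identity of rational
      functions.\<close>
    have alg: "(1 / q * x * (1 - y) + 2 / r * s - 1 / r * t - 1) * (r * q) = q * (2 * s - t - r) - r * (x * y - x)"
      if "q \<noteq> 0" "r \<noteq> 0" for q r s t x y :: real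
      using that by (simp add: field_simps)
    show ?thesis unfolding N_all_def N_c_def pow by (rule alg[OF nz])
  qed
  then have "real (card (orbits affine_group connection_sets affine_action)) * ((real p - 1) * real p)
      = (N_all p - N_c p - 1) * ((real p - 1) * real p)" using main by simp
  then show ?thesis using nz by simp
qed

end

section \<open>Cayley digraphs of the dihedral group\<close>

text \<open>\<open>e (i, a)\<close> is \<open>t\<close> to the power \<open>i\<close>, times
  \<open>s\<close> if \<open>a\<close>. It is defined for all integers and periodic mod
  \<open>n\<close>. The relations make its range closed under multiplication by letters, hence
  everything; injectivity on reduced pairs follows from the order \<open>2 * n\<close> of the
  group.\<close>

lemma dihedral_coordinates:
  assumes "n > 0"
  obtains e :: "int \<times> bool \<Rightarrow> dihedral_gen word set" where
    "bij_betw e ({0..<int n} \<times> UNIV) (carrier (dihedral_group n))"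
    "\<And>i j a b. e (i, a) \<otimes>\<^bsub>dihedral_group n\<^esub> e (j, b)
        = e ((if a then i - j else i + j) mod int n, a \<noteq> b)"
    "e (0, False) = \<one>\<^bsub>dihedral_group n\<^esub>"
proof -
  define R where "R = dihedral_relators n"
  define G where "G = dihedral_group n"
  define t where "t = word_class R [(Gen_tau, True)]"
  define s where "s = word_class R [(Gen_sigma, True)]"
  interpret group G unfolding G_def by (rule group_dihedral_group)
  have G: "G = presented_group R" by (simp add: G_def R_def dihedral_group_def)
  have mult: "word_class R u \<otimes>\<^bsub>G\<^esub> word_class R v = word_class R (u @ v)" for u v
    by (simp add: G word_class_mult)
  have one: "\<one>\<^bsub>G\<^esub> = word_class R []" by (simp add: G presented_group_def)
  have carr[simp]: "word_class R w \<in> carrier G" for w by (simp add: G presented_group_def)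
  have ts[simp]: "t \<in> carrier G" "s \<in> carrier G" by (simp_all add: t_def s_def)
  have rel: "word_class R r = \<one>\<^bsub>G\<^esub>" if "r \<in> R" for r
    using that unfolding one word_class_eq_iff by (rule word_eq_relator)
  have pow: "word_class R (replicate k (Gen_tau, True)) = t [^]\<^bsub>G\<^esub> k" for k :: nat
  proof (induction k)
    case (Suc k)
    have "t [^]\<^bsub>G\<^esub> Suc k = word_class R (replicate k (Gen_tau, True) @ [(Gen_tau, True)])"
      unfolding nat_pow_Suc Suc[symmetric] by (simp only: t_def mult)
    then show ?case by (simp add: replicate_append_same)
  qed (simp add: one)
  have tn: "t [^]\<^bsub>G\<^esub> int n = \<one>\<^bsub>G\<^esub>"
    using rel[of "replicate n (Gen_tau, True)"] unfolding pow
    by (simp add: R_def dihedral_relators_def int_pow_int)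
  have ss: "s \<otimes>\<^bsub>G\<^esub> s = \<one>\<^bsub>G\<^esub>"
    using rel[of "[(Gen_sigma, True), (Gen_sigma, True)]"]
    unfolding s_def mult by (simp add: R_def dihedral_relators_def numeral_2_eq_2)
  have s': "inv\<^bsub>G\<^esub> s = s" using ss by (intro inv_equality) auto
  have st: "s \<otimes>\<^bsub>G\<^esub> t = inv\<^bsub>G\<^esub> t \<otimes>\<^bsub>G\<^esub> s"
  proof -
    have "(s \<otimes>\<^bsub>G\<^esub> t) \<otimes>\<^bsub>G\<^esub> (s \<otimes>\<^bsub>G\<^esub> t) = \<one>\<^bsub>G\<^esub>"
      using rel[of "[(Gen_sigma, True), (Gen_tau, True), (Gen_sigma, True), (Gen_tau, True)]"]
      unfolding s_def t_def mult by (simp add: R_def dihedral_relators_def)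
    then have "inv\<^bsub>G\<^esub> (s \<otimes>\<^bsub>G\<^esub> t) = s \<otimes>\<^bsub>G\<^esub> t"
      by (intro inv_equality) auto
    then show ?thesis by (simp add: inv_mult_group s')
  qed
  have st': "s \<otimes>\<^bsub>G\<^esub> inv\<^bsub>G\<^esub> t = t \<otimes>\<^bsub>G\<^esub> s"
  proof -
    have "s \<otimes>\<^bsub>G\<^esub> inv\<^bsub>G\<^esub> t = t \<otimes>\<^bsub>G\<^esub> (inv\<^bsub>G\<^esub> t \<otimes>\<^bsub>G\<^esub> s) \<otimes>\<^bsub>G\<^esub> inv\<^bsub>G\<^esub> t"
      by (simp add: m_assoc[symmetric])
    also have "\<dots> = t \<otimes>\<^bsub>G\<^esub> s" by (simp add: st[symmetric] m_assoc)
    finally show ?thesis .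
  qed
  have pow_add: "t [^]\<^bsub>G\<^esub> i \<otimes>\<^bsub>G\<^esub> t [^]\<^bsub>G\<^esub> j = t [^]\<^bsub>G\<^esub> (i + j)" for i j :: int
    by (simp add: int_pow_mult)
  have t1: "t [^]\<^bsub>G\<^esub> (1 :: int) = t" "t [^]\<^bsub>G\<^esub> (- 1 :: int) = inv\<^bsub>G\<^esub> t"
    by (simp_all add: int_pow_neg)
  \<comment> \<open>Moving \<open>s\<close> past a power of \<open>t\<close> inverts the power;
    integer induction needs a step with \<open>t\<close> and one with its inverse.\<close>
  have spow: "s \<otimes>\<^bsub>G\<^esub> t [^]\<^bsub>G\<^esub> i = t [^]\<^bsub>G\<^esub> (- i) \<otimes>\<^bsub>G\<^esub> s" for i :: int
  proof (induction i rule: int_induct[of _ 0])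
    case (step1 i)
    have "s \<otimes>\<^bsub>G\<^esub> t [^]\<^bsub>G\<^esub> (i + 1) = s \<otimes>\<^bsub>G\<^esub> t [^]\<^bsub>G\<^esub> i \<otimes>\<^bsub>G\<^esub> t"
      using pow_add[of i 1] by (simp add: t1 m_assoc)
    also have "\<dots> = t [^]\<^bsub>G\<^esub> (- i) \<otimes>\<^bsub>G\<^esub> (inv\<^bsub>G\<^esub> t \<otimes>\<^bsub>G\<^esub> s)" by (simp add: step1 m_assoc st)
    also have "\<dots> = t [^]\<^bsub>G\<^esub> (- (i + 1)) \<otimes>\<^bsub>G\<^esub> s"
      using pow_add[of "- i" "- 1"] by (simp add: t1 m_assoc[symmetric])
    finally show ?case .
  next
    case (step2 i)
    have "s \<otimes>\<^bsub>G\<^esub> t [^]\<^bsub>G\<^esub> (i - 1) = s \<otimes>\<^bsub>G\<^esub> t [^]\<^bsub>G\<^esub> i \<otimes>\<^bsub>G\<^esub> inv\<^bsub>G\<^esub> t"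
      using pow_add[of i "- 1"] by (simp add: t1 m_assoc)
    also have "\<dots> = t [^]\<^bsub>G\<^esub> (- i) \<otimes>\<^bsub>G\<^esub> (t \<otimes>\<^bsub>G\<^esub> s)" by (simp add: step2 m_assoc st')
    also have "\<dots> = t [^]\<^bsub>G\<^esub> (- (i - 1)) \<otimes>\<^bsub>G\<^esub> s"
      using pow_add[of "- i" "1"] by (simp add: t1 m_assoc[symmetric])
    finally show ?case .
  qed simp
  define e where "e = (\<lambda>(i :: int, a). t [^]\<^bsub>G\<^esub> i \<otimes>\<^bsub>G\<^esub> (if a then s else \<one>\<^bsub>G\<^esub>))"
  have powmod: "t [^]\<^bsub>G\<^esub> (i mod int n) = t [^]\<^bsub>G\<^esub> i" for i :: int
  proof -
    have "t [^]\<^bsub>G\<^esub> i = t [^]\<^bsub>G\<^esub> (int n * (i div int n) + i mod int n)" by simp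
    also have "\<dots> = (t [^]\<^bsub>G\<^esub> int n) [^]\<^bsub>G\<^esub> (i div int n) \<otimes>\<^bsub>G\<^esub> t [^]\<^bsub>G\<^esub> (i mod int n)"
      by (simp only: pow_add[symmetric] int_pow_pow ts)
    finally show ?thesis by (simp only: tn int_pow_one l_one int_pow_closed ts)
  qed
  have emod: "e (i mod int n, a) = e (i, a)" for i a by (simp add: e_def powmod)
  have emult: "e (i, a) \<otimes>\<^bsub>G\<^esub> e (j, b) = e (if a then i - j else i + j, a \<noteq> b)" for i j a b
  proof (cases a)
    case True
    have "e (i, a) \<otimes>\<^bsub>G\<^esub> e (j, b) = t [^]\<^bsub>G\<^esub> i \<otimes>\<^bsub>G\<^esub> (s \<otimes>\<^bsub>G\<^esub> t [^]\<^bsub>G\<^esub> j) \<otimes>\<^bsub>G\<^esub> (if b then s else \<one>\<^bsub>G\<^esub>)"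
      using True by (simp add: e_def m_assoc)
    also have "\<dots> = (t [^]\<^bsub>G\<^esub> i \<otimes>\<^bsub>G\<^esub> t [^]\<^bsub>G\<^esub> (- j)) \<otimes>\<^bsub>G\<^esub> (s \<otimes>\<^bsub>G\<^esub> (if b then s else \<one>\<^bsub>G\<^esub>))"
      by (simp add: spow m_assoc)
    finally show ?thesis using True ss by (simp add: pow_add e_def)
  next
    case False
    then show ?thesis by (simp add: e_def m_assoc[symmetric] pow_add)
  qed
  have e_carr: "e x \<in> carrier G" for x by (cases x) (simp add: e_def)
  have e1: "e (0, False) = \<one>\<^bsub>G\<^esub>" by (simp add: e_def)
  have letter: "word_class R [l] \<in> range e" for l
  proof -
    obtain x b where l: "l = (x, b)" by (cases l)
    have gen: "word_class R [(x, True)] = e (case x of Gen_tau \<Rightarrow> (1, False) | Gen_sigma \<Rightarrow> (0, True))"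
      by (cases x) (simp_all add: e_def t1 flip: t_def s_def)
    have "inv\<^bsub>G\<^esub> word_class R [(x, True)] = word_class R [(x, False)]"
      using word_eq_cancel[of R x False]
      by (intro inv_equality) (simp_all add: mult one word_class_eq_iff)
    moreover have "inv\<^bsub>G\<^esub> word_class R [(x, True)]
        = e (case x of Gen_tau \<Rightarrow> (- 1, False) | Gen_sigma \<Rightarrow> (0, True))"
      by (cases x) (simp_all add: e_def t1 s' flip: t_def s_def)
    ultimately show ?thesis using gen by (cases b) (auto simp: l)
  qed
  have "word_class R w \<in> range e" for w
  proof (induction w)
    case Nil
    then show ?case using e1 by (metis one rangeI)
  next
    case (Cons l w)
    obtain x y where xy: "word_class R [l] = e x" "word_class R w = e y"
      using letter[of l] Cons by auto
    have "word_class R (l # w) = e x \<otimes>\<^bsub>G\<^esub> e y" unfolding xy[symmetric] mult by simp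
    then show ?case by (cases x; cases y) (simp add: emult)
  qed
  then have "carrier G \<subseteq> range e" by (auto simp: G presented_group_def)
  moreover have "range e \<subseteq> e ` ({0..<int n} \<times> UNIV)"
  proof
    fix y assume "y \<in> range e"
    then obtain i a where "y = e (i, a)" by auto
    then have "y = e (i mod int n, a)" by (simp add: emod)
    then show "y \<in> e ` ({0..<int n} \<times> UNIV)" using assms by (intro image_eqI) auto
  qed
  ultimately have im: "e ` ({0..<int n} \<times> UNIV) = carrier G" using e_carr by auto
  moreover have "card (carrier G) = card ({0..<int n} \<times> (UNIV :: bool set))"
    using order_dihedral_group[OF assms] by (simp add: order_def G_def card_cartesian_product)
  ultimately have "inj_on e ({0..<int n} \<times> UNIV)"
    by (intro eq_card_imp_inj_on) auto
  with im have "bij_betw e ({0..<int n} \<times> UNIV) (carrier G)" by (simp add: bij_betw_def)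
  then show thesis using that[of e] emult e1 emod by (simp add: G_def)
qed

section \<open>Cayley digraphs on labelled vertices\<close>

text \<open>Calculations with classes of words are replaced by a bijection \<open>e\<close> that
  comes with the multiplication rule of the coordinates.\<close>

locale dihedral_labelling = odd_prime +
  fixes e :: "int \<times> bool \<Rightarrow> dihedral_gen word set"
  assumes bij: "bij_betw e V (carrier (dihedral_group p))"
    and e_mult: "\<And>i j a b. e (i, a) \<otimes>\<^bsub>dihedral_group p\<^esub> e (j, b)
        = e ((if a then i - j else i + j) mod int p, a \<noteq> b)"
    and e_one: "e (0, False) = \<one>\<^bsub>dihedral_group p\<^esub>"
begin

abbreviation (input) "G \<equiv> dihedral_group p"

definition cay :: "(int \<times> bool) set \<Rightarrow> (dihedral_gen word set, dihedral_gen word set \<times> dihedral_gen word set) pre_digraph"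
  where "cay S = cayley_digraph G (e ` S)"

lemma e_inj: "inj_on e V" and e_image: "e ` V = carrier G"
  using bij by (auto simp: bij_betw_def)

lemma e_eq_iff: "u \<in> V \<Longrightarrow> v \<in> V \<Longrightarrow> e u = e v \<longleftrightarrow> u = v"
  using e_inj by (auto dest: inj_onD)

lemma e_arrow:
  assumes "u \<in> V" "v \<in> V"
  shows "e v \<otimes>\<^bsub>G\<^esub> inv\<^bsub>G\<^esub> e u = e (arrow u v)"
proof -
  interpret group G by (rule group_dihedral_group)
  have mem: "e w \<in> carrier G" if "w \<in> V" for w using that e_image by blast
  have aV: "arrow u v \<in> V" by (simp add: arrow_def)
  \<comment> \<open>The quotient is verified by multiplying back with \<open>e u\<close>, which
    avoids a formula for inverses in coordinates.\<close>
  have "e (arrow u v) \<otimes>\<^bsub>G\<^esub> e u = e v"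
    using V_mod[OF assms(2)]
    by (cases u; cases v) (auto simp: arrow_def e_mult mod_simps)
  then have "e v \<otimes>\<^bsub>G\<^esub> inv\<^bsub>G\<^esub> e u = (e (arrow u v) \<otimes>\<^bsub>G\<^esub> e u) \<otimes>\<^bsub>G\<^esub> inv\<^bsub>G\<^esub> e u" by simp
  also have "\<dots> = e (arrow u v)" using mem[OF aV] mem[OF assms(1)] by (simp add: m_assoc)
  finally show ?thesis .
qed

lemma verts_cay: "verts (cay S) = e ` V" and tail_cay: "tail (cay S) = fst" and head_cay: "head (cay S) = snd"
  by (simp_all add: cay_def cayley_digraph_def e_image)

lemma arcs_cay_iff:
  assumes S: "S \<subseteq> V" and uv: "u \<in> V" "v \<in> V"
  shows "(e u, e v) \<in> arcs (cay S) \<longleftrightarrow> arrow u v \<in> S"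
proof -
  have "(e u, e v) \<in> arcs (cay S) \<longleftrightarrow> e (arrow u v) \<in> e ` S"
    using uv e_image by (auto simp: cay_def cayley_digraph_def e_arrow)
  also have "\<dots> \<longleftrightarrow> arrow u v \<in> S"
    using S by (auto simp: e_eq_iff arrow_def inj_on_image_mem_iff[OF e_inj])
  finally show ?thesis .
qed

lemma arcs_cay: "arcs (cay S) \<subseteq> e ` V \<times> e ` V"
  using e_image by (auto simp: cay_def cayley_digraph_def)

lemma arcs_ends_cay: "arcs_ends (cay S) = arcs (cay S)"
  by (auto simp: arcs_ends_conv tail_cay head_cay)

text \<open>The out-neighbours of the identity recover the connection set.\<close>

lemma cay_inj: "inj_on cay (Pow V)"
proof (rule inj_onI)
  fix S T assume ST: "S \<in> Pow V" "T \<in> Pow V" "cay S = cay T"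
  have "v \<in> S \<longleftrightarrow> v \<in> T" if "v \<in> V" for v
    using arcs_cay_iff[OF _ zero_in_V that, of S False] arcs_cay_iff[OF _ zero_in_V that, of T False] ST
    by (simp add: arrow_from_zero[OF that])
  then show "S = T" using ST by blast
qed

section \<open>Connectedness\<close>

text \<open>Connectedness refers to paths that ignore directions, so closure of \<open>I\<close> is
  required both ways along an arrow. One direction is induction along a path; the other takes for
  \<open>I\<close> the component of the identity.\<close>

lemma connected_cay_iff_closed:
  assumes S: "S \<subseteq> V"
  shows "Digraph_Component.connected (cay S) \<longleftrightarrow>
    (\<forall>I. (0, False) \<in> I \<longrightarrow> (\<forall>u\<in>V. \<forall>v\<in>V. arrow u v \<in> S \<longrightarrow> (u \<in> I \<longleftrightarrow> v \<in> I)) \<longrightarrow> V \<subseteq> I)"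
    (is "_ \<longleftrightarrow> ?closed")
proof
  assume con: "Digraph_Component.connected (cay S)"
  show ?closed
  proof (intro allI impI subsetI)
    fix I v assume I0: "(0, False) \<in> I" and I: "\<forall>u\<in>V. \<forall>v\<in>V. arrow u v \<in> S \<longrightarrow> (u \<in> I \<longleftrightarrow> v \<in> I)"
      and v: "v \<in> V"
    have inv: "x \<in> e ` (I \<inter> V) \<longleftrightarrow> y \<in> e ` (I \<inter> V)" if xy: "(x, y) \<in> arcs (cay S)" for x y
    proof -
      obtain u w where uw: "u \<in> V" "w \<in> V" "x = e u" "y = e w" using xy arcs_cay by blast
      then have "u \<in> I \<longleftrightarrow> w \<in> I" using xy I arcs_cay_iff[OF S, of u w] by blast
      then show ?thesis using uw by (auto simp: e_eq_iff)
    qed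
    have "(e (0, False), e v) \<in> rtrancl_on (verts (cay S)) ((arcs_ends (cay S))\<^sup>s)"
      using con v zero_in_V unfolding connected_conv by (simp add: verts_cay)
    then have "e v \<in> e ` (I \<inter> V)"
    proof (induction rule: rtrancl_on_induct)
      case base
      then show ?case using I0 zero_in_V by auto
    next
      case (step y z)
      then have "(y, z) \<in> arcs (cay S) \<or> (z, y) \<in> arcs (cay S)" by (auto simp: arcs_ends_cay symcl_def)
      then show ?case using step.IH inv by blast
    qed
    then show "v \<in> I" using v by (auto simp: e_eq_iff)
  qed
next
  assume closed: ?closed
  let ?r = "rtrancl_on (verts (cay S)) ((arcs_ends (cay S))\<^sup>s)"
  have sym_r: "sym ?r" by (intro rtrancl_on_sym) (auto simp: symcl_def sym_def)
  define I where "I = {v \<in> V. (e (0, False), e v) \<in> ?r}"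
  have "(0, False) \<in> I" using zero_in_V by (auto simp: I_def verts_cay)
  moreover have "u \<in> I \<longleftrightarrow> v \<in> I" if uv: "u \<in> V" "v \<in> V" "arrow u v \<in> S" for u v
  proof -
    have "(e u, e v) \<in> (arcs_ends (cay S))\<^sup>s" "(e v, e u) \<in> (arcs_ends (cay S))\<^sup>s"
      using arcs_cay_iff[OF S uv(1,2)] uv by (auto simp: arcs_ends_cay symcl_def)
    then show ?thesis using uv
      by (auto simp: I_def verts_cay intro: rtrancl_on_into_rtrancl_on)
  qed
  ultimately have "V \<subseteq> I" using closed by blast
  then have from0: "(e (0, False), x) \<in> ?r" if "x \<in> verts (cay S)" for x
    using that by (auto simp: I_def verts_cay)
  then have "(x, y) \<in> ?r" if "x \<in> verts (cay S)" "y \<in> verts (cay S)" for x y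
    using that sym_r by (metis rtrancl_on_trans symD)
  then show "Digraph_Component.connected (cay S)"
    unfolding connected_conv using zero_in_V by (auto simp: verts_cay)
qed

text \<open>A set of rotations never leaves the rotations, and a single reflection \<open>b\<close>
  only joins the identity to \<open>b\<close>. Otherwise a reflection and a second element yield a
  nonzero rotation step, whose multiples reach every rotation, and the reflection then leads to the
  other side.\<close>

lemma connected_cay_iff:
  assumes S: "S \<subseteq> V" and S0: "(0, False) \<notin> S"
  shows "Digraph_Component.connected (cay S) \<longleftrightarrow> S \<in> connection_sets"
proof
  assume "Digraph_Component.connected (cay S)"
  then have closed: "V \<subseteq> I"
    if "(0, False) \<in> I" "\<And>u v. u \<in> V \<Longrightarrow> v \<in> V \<Longrightarrow> arrow u v \<in> S \<Longrightarrow> u \<in> I \<longleftrightarrow> v \<in> I" for I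
    using that unfolding connected_cay_iff_closed[OF S] by blast
  have "\<exists>x. (x, True) \<in> S"
  proof (rule ccontr)
    assume "\<not> ?thesis"
    then have "V \<subseteq> {v. \<not> snd v}" by (intro closed) (auto simp: arrow_def split: if_splits)
    then show False using zero_in_V[of True] by auto
  qed
  moreover have "S \<noteq> {(b, True)}" for b
  proof
    assume Sb: "S = {(b, True)}"
    then have b: "b mod int p = b" using S by (auto simp: V_def)
    have "V \<subseteq> {(0, False), (b, True)}"
    proof (rule closed)
      fix u v assume uv: "u \<in> V" "v \<in> V" "arrow u v \<in> S"
      obtain x s y t where xy: "u = (x, s)" "v = (y, t)" by (cases u; cases v)
      have st: "t = (\<not> s)" and sum: "[x + y = b] (mod int p)"
        using uv(3) Sb b by (auto simp: arrow_def xy cong_def split: if_splits)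
      have xm: "x mod int p = x" "y mod int p = y" using uv V_mod xy by fastforce+
      have "x = 0 \<longleftrightarrow> y = b"
      proof
        assume "x = 0" then show "y = b" using sum b xm by (simp add: cong_def)
      next
        assume "y = b"
        then have "[x = 0] (mod int p)" using sum by (simp add: cong_iff_dvd_diff)
        then show "x = 0" using xm by (simp add: cong_def)
      qed
      moreover have "y = 0 \<longleftrightarrow> x = b"
      proof
        assume "y = 0" then show "x = b" using sum b xm by (simp add: cong_def)
      next
        assume "x = b"
        then have "[y = 0] (mod int p)" using sum by (simp add: cong_iff_dvd_diff)
        then show "y = 0" using xm by (simp add: cong_def)
      qed
      ultimately show "u \<in> {(0, False), (b, True)} \<longleftrightarrow> v \<in> {(0, False), (b, True)}"
        by (auto simp: xy st)
    qed simp
    moreover have "(1, False) \<in> V" using p_ge_3 by (simp add: V_def)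
    ultimately show False by auto
  qed
  ultimately show "S \<in> connection_sets" using S S0 by (auto simp: connection_sets_def)
next
  assume "S \<in> connection_sets"
  then obtain b where b: "(b, True) \<in> S" and ns: "S \<noteq> {(b, True)}" by (auto simp: connection_sets_def)
  show "Digraph_Component.connected (cay S)"
    unfolding connected_cay_iff_closed[OF S]
  proof (intro allI impI)
    fix I assume I0: "(0, False) \<in> I" and I: "\<forall>u\<in>V. \<forall>v\<in>V. arrow u v \<in> S \<longrightarrow> (u \<in> I \<longleftrightarrow> v \<in> I)"
    have cross: "(x mod int p, False) \<in> I \<longleftrightarrow> (y mod int p, True) \<in> I"
      if "(c, True) \<in> S" "[x + y = c] (mod int p)" for x y c
    proof -
      have "c mod int p = c" using that(1) S V_mod by fastforce
      then have "arrow (x mod int p, False) (y mod int p, True) = (c, True)"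
        using that(2) by (simp add: arrow_def mod_simps cong_def)
      then show ?thesis using I that(1) by (metis mod_in_V)
    qed
    \<comment> \<open>The step is the difference of two reflections in \<open>S\<close>, or a
      rotation in \<open>S\<close>.\<close>
    obtain d where nd: "\<not> int p dvd d"
      and step: "\<And>x. (x mod int p, False) \<in> I \<Longrightarrow> ((x + d) mod int p, False) \<in> I"
    proof -
      obtain a s where as: "(a, s) \<in> S" "(a, s) \<noteq> (b, True)" using b ns by auto
      have am: "a mod int p = a" "b mod int p = b" using as b S V_mod by fastforce+
      show thesis
      proof (cases s)
        case True
        have "\<not> int p dvd a - b"
        proof
          assume "int p dvd a - b"
          then have "a mod int p = b mod int p" by (simp add: mod_eq_dvd_iff)
          then show False using am as True by simp
        qed
        \<comment> \<open>The rotations \<open>x\<close> and \<open>x + (a - b)\<close> are both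
          adjacent to the reflection \<open>b - x\<close>.\<close>
        moreover have "((x + (a - b)) mod int p, False) \<in> I" if "(x mod int p, False) \<in> I" for x
          using cross[OF b, of x "b - x"] cross[of a "x + (a - b)" "b - x"] as True that by simp
        ultimately show thesis using that by blast
      next
        case False
        have "\<not> int p dvd a"
        proof
          assume "int p dvd a"
          then have "a = 0" using am by (simp add: dvd_eq_mod_eq_0)
          then show False using as S0 False by simp
        qed
        moreover have "((x + a) mod int p, False) \<in> I" if "(x mod int p, False) \<in> I" for x
        proof -
          have "arrow (x mod int p, False) ((x + a) mod int p, False) = (a, False)"
            using am by (simp add: arrow_def mod_simps)
          then show ?thesis using I as that False by (metis mod_in_V)
        qed
        ultimately show thesis using that by blast
      qed
    qed
    have mult: "(int n * d mod int p, False) \<in> I" for n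
    proof (induction n)
      case (Suc n)
      then show ?case using step[of "int n * d"] by (simp add: algebra_simps)
    qed (use I0 in simp)
    have rotI: "(y mod int p, False) \<in> I" for y
    proof -
      obtain i where i: "[d * i = 1] (mod int p)" using inverse_mod_exists[OF nd] .
      define n where "n = nat ((i * y) mod int p)"
      have n: "int n = (i * y) mod int p" using p_ge_3 by (simp add: n_def)
      have "[int n * d = y] (mod int p)"
        using cong_scalar_right[OF i, of y] unfolding n by (simp add: cong_def mod_simps mult_ac)
      then show ?thesis using mult[of n] by (simp add: cong_def)
    qed
    show "V \<subseteq> I"
    proof
      fix v assume v: "v \<in> V"
      obtain y s where ys: "v = (y, s)" "y mod int p = y" using V_mod[OF v] by (cases v) auto
      show "v \<in> I"
        using cross[OF b, of "b - y" y] rotI[of "b - y"] rotI[of y] ys by (cases s) auto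
    qed
  qed
qed

section \<open>Isomorphism as affine equivalence\<close>

text \<open>Arcs are pairs of vertices, so the vertex map of an isomorphism carries one arc set to
  the other. Conjugating it by \<open>e\<close> and extending by the identity outside
  \<open>V\<close> gives \<open>\<psi>\<close>.\<close>

lemma digraph_iso_cay_imp:
  assumes S: "S \<subseteq> V" and T: "T \<subseteq> V" and iso: "digraph_iso (cay S) (cay T)"
  shows "\<exists>\<psi>. \<psi> permutes V \<and> (\<forall>u\<in>V. \<forall>v\<in>V. arrow (\<psi> u) (\<psi> v) \<in> T \<longleftrightarrow> arrow u v \<in> S)"
proof -
  interpret C: wf_digraph "cay S" unfolding cay_def by (rule wf_cayley_digraph)
  obtain f where f: "C.digraph_isomorphism f" "cay T = app_iso f (cay S)"
    using iso by (auto simp: digraph_iso_def)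
  define F where "F = iso_verts f"
  have inj: "inj_on F (e ` V)"
    using C.digraph_isomorphism_inj_on_verts[OF f(1)] by (simp add: F_def verts_cay)
  have im: "F ` e ` V = e ` V"
    using arg_cong[OF f(2), of verts] by (simp add: F_def verts_cay)
  have arcs: "arcs (cay T) = (\<lambda>(x, y). (F x, F y)) ` arcs (cay S)"
    using C.arcs_ends_app_iso_eq[OF f(1)] unfolding f(2)[symmetric] arcs_ends_cay F_def .
  define \<psi> where "\<psi> v = (if v \<in> V then inv_into V e (F (e v)) else v)" for v
  have e\<psi>: "e (\<psi> v) = F (e v)" "\<psi> v \<in> V" if "v \<in> V" for v
  proof -
    have "F (e v) \<in> e ` V" using im that by blast
    then show "e (\<psi> v) = F (e v)" "\<psi> v \<in> V" using that by (auto simp: \<psi>_def f_inv_into_f inv_into_into)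
  qed
  have "inj_on \<psi> V"
  proof (rule inj_onI)
    fix u v assume uv: "u \<in> V" "v \<in> V" "\<psi> u = \<psi> v"
    then have "F (e u) = F (e v)" using e\<psi> by metis
    then have "e u = e v" using inj uv by (auto dest: inj_onD)
    then show "u = v" using e_eq_iff uv by blast
  qed
  moreover have "\<psi> ` V \<subseteq> V" using e\<psi> by blast
  ultimately have "bij_betw \<psi> V V"
    using endo_inj_surj[OF finite_V] by (simp add: bij_betw_def)
  then have "\<psi> permutes V" by (rule bij_imp_permutes) (simp add: \<psi>_def)
  moreover have "arrow (\<psi> u) (\<psi> v) \<in> T \<longleftrightarrow> arrow u v \<in> S" if uv: "u \<in> V" "v \<in> V" for u v
  proof -
    have "arrow (\<psi> u) (\<psi> v) \<in> T \<longleftrightarrow> (F (e u), F (e v)) \<in> arcs (cay T)"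
      using arcs_cay_iff[OF T e\<psi>(2)[OF uv(1)] e\<psi>(2)[OF uv(2)]] e\<psi>(1) uv by simp
    also have "\<dots> \<longleftrightarrow> (e u, e v) \<in> arcs (cay S)"
    proof
      assume "(F (e u), F (e v)) \<in> arcs (cay T)"
      then obtain x y where xy: "(x, y) \<in> arcs (cay S)" "F x = F (e u)" "F y = F (e v)"
        by (auto simp: arcs)
      moreover have "x \<in> e ` V" "y \<in> e ` V" using xy(1) arcs_cay by blast+
      ultimately have "x = e u" "y = e v" using inj uv by (auto dest: inj_onD)
      then show "(e u, e v) \<in> arcs (cay S)" using xy by simp
    qed (auto simp: arcs)
    also have "\<dots> \<longleftrightarrow> arrow u v \<in> S" by (rule arcs_cay_iff[OF S uv])
    finally show ?thesis .
  qed
  ultimately show ?thesis by blast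
qed

text \<open>Asking for \<open>bij_betw\<close> in place of \<open>permutes\<close> admits
  \<open>aff m c\<close>, which does not fix the points outside \<open>V\<close>.\<close>

lemma digraph_iso_cayI:
  assumes S: "S \<subseteq> V" and T: "T \<subseteq> V" and bij\<psi>: "bij_betw \<psi> V V"
    and iso: "\<And>u v. u \<in> V \<Longrightarrow> v \<in> V \<Longrightarrow> arrow (\<psi> u) (\<psi> v) \<in> T \<longleftrightarrow> arrow u v \<in> S"
  shows "digraph_iso (cay S) (cay T)"
proof -
  interpret C: wf_digraph "cay S" unfolding cay_def by (rule wf_cayley_digraph)
  define F where "F x = e (\<psi> (inv_into V e x))" for x
  have Fe: "F (e v) = e (\<psi> v)" if "v \<in> V" for v using that e_inj by (simp add: F_def)
  have \<psi>V: "\<psi> v \<in> V" if "v \<in> V" for v using bij\<psi> that by (auto simp: bij_betw_def)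
  have inj: "inj_on F (e ` V)"
  proof (rule inj_onI)
    fix x y assume xy: "x \<in> e ` V" "y \<in> e ` V" "F x = F y"
    then obtain u v where uv: "u \<in> V" "v \<in> V" "x = e u" "y = e v" by blast
    then have "\<psi> u = \<psi> v" using xy Fe \<psi>V e_eq_iff by auto
    then show "x = y" using bij\<psi> uv by (auto simp: bij_betw_def dest: inj_onD)
  qed
  have arcs: "arcs (cay T) = map_prod F F ` arcs (cay S)"
  proof (intro equalityI subsetI)
    fix z assume z: "z \<in> arcs (cay T)"
    then obtain u' v' where uv': "u' \<in> V" "v' \<in> V" "z = (e u', e v')"
      using arcs_cay by blast
    have "u' \<in> \<psi> ` V" "v' \<in> \<psi> ` V" using uv' bij\<psi> by (simp_all add: bij_betw_def)
    then obtain u v where uv: "u \<in> V" "v \<in> V" "u' = \<psi> u" "v' = \<psi> v" by blast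
    have "(e u, e v) \<in> arcs (cay S)"
      using z uv uv' iso arcs_cay_iff[OF T, of u' v'] arcs_cay_iff[OF S, of u v]
      by simp
    then show "z \<in> map_prod F F ` arcs (cay S)"
      using uv uv' Fe by (intro image_eqI[of _ _ "(e u, e v)"]) auto
  next
    fix z assume "z \<in> map_prod F F ` arcs (cay S)"
    then obtain x y where xy: "(x, y) \<in> arcs (cay S)" "z = (F x, F y)" by auto
    then obtain u v where uv: "u \<in> V" "v \<in> V" "x = e u" "y = e v"
      using arcs_cay by blast
    then show "z \<in> arcs (cay T)"
      using xy iso[of u v] \<psi>V arcs_cay_iff[OF T, of "\<psi> u" "\<psi> v"]
        arcs_cay_iff[OF S, of u v] Fe by simp
  qed
  define f where "f = \<lparr>iso_verts = F, iso_arcs = map_prod F F, iso_head = snd, iso_tail = fst\<rparr>"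
  have "F ` e ` V = e ` V"
  proof -
    have "F ` e ` V = e ` \<psi> ` V" using Fe by (auto simp: image_image)
    then show ?thesis using bij\<psi> by (simp add: bij_betw_def)
  qed
  moreover have "C.digraph_isomorphism f"
  proof -
    have "inj_on (map_prod F F) (arcs (cay S))"
      by (rule inj_on_subset[OF map_prod_inj_on[OF inj inj] arcs_cay])
    then show ?thesis
      using inj by (auto simp: C.digraph_isomorphism_def f_def C.wf_digraph_axioms
          verts_cay tail_cay head_cay)
  qed
  moreover have "tail (cay T) = fst" "head (cay T) = snd" "verts (cay T) = e ` V"
    using verts_cay tail_cay head_cay by auto
  ultimately show ?thesis
    unfolding digraph_iso_def
    by (intro exI[of _ f]) (auto simp: app_iso_def f_def arcs verts_cay intro!: pre_digraph.equality)
qed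

text \<open>The CI property in coordinates: the Sylow argument gives one direction, and the other
  holds because an affine bijection preserves quotients.\<close>

lemma digraph_iso_cay_iff:
  assumes S: "S \<subseteq> V" and T: "T \<subseteq> V"
  shows "digraph_iso (cay S) (cay T) \<longleftrightarrow> (\<exists>m c. \<not> int p dvd m \<and> T = aff m c ` S)"
proof
  assume "digraph_iso (cay S) (cay T)"
  then obtain \<psi> where \<psi>: "\<psi> permutes V"
    "\<forall>u\<in>V. \<forall>v\<in>V. arrow (\<psi> u) (\<psi> v) \<in> T \<longleftrightarrow> arrow u v \<in> S"
    using digraph_iso_cay_imp[OF S T] by blast
  then obtain m c where mc: "\<not> int p dvd m" "\<forall>v\<in>V. aff m c v \<in> T \<longleftrightarrow> v \<in> S"
    using connection_sets_affine_equivalent[of \<psi> T S] by blast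
  obtain m' c' where inv: "\<forall>v\<in>V. aff m c (aff m' c' v) = v" by (rule aff_inverse[OF mc(1), of c])
  have "T = aff m c ` S"
  proof (intro equalityI subsetI)
    fix v assume v: "v \<in> T"
    then have "aff m c (aff m' c' v) = v" using inv T by blast
    moreover from this have "aff m' c' v \<in> S" using mc(2) v by (metis aff_in_V)
    ultimately show "v \<in> aff m c ` S" by (metis imageI)
  qed (use mc(2) S in blast)
  then show "\<exists>m c. \<not> int p dvd m \<and> T = aff m c ` S" using mc(1) by blast
next
  assume "\<exists>m c. \<not> int p dvd m \<and> T = aff m c ` S"
  then obtain m c where mc: "\<not> int p dvd m" "T = aff m c ` S" by blast
  note inj = inj_on_aff[OF mc(1), of c]
  show "digraph_iso (cay S) (cay T)"
  proof (rule digraph_iso_cayI[OF S T])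
    have "aff m c ` V \<subseteq> V" by auto
    then show "bij_betw (aff m c) V V"
      using inj endo_inj_surj[OF finite_V] by (simp add: bij_betw_def)
    fix u v assume "u \<in> V" "v \<in> V"
    have "arrow u v \<in> V" by (simp add: arrow_def)
    then show "arrow (aff m c u) (aff m c v) \<in> T \<longleftrightarrow> arrow u v \<in> S"
      unfolding arrow_aff mc(2) by (rule inj_on_image_mem_iff[OF inj _ S])
  qed
qed

section \<open>From isomorphism classes to orbits\<close>

lemma connected_cayley_digraphs_eq: "connected_cayley_digraphs (dihedral_group p) = cay ` connection_sets"
proof -
  have conn: "Digraph_Component.connected (cay S) \<longleftrightarrow> S \<in> connection_sets"
    if "S \<subseteq> V" "(0, False) \<notin> S" for S
    using connected_cay_iff[OF that] .
  show ?thesis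
  proof (intro equalityI subsetI)
    fix D assume "D \<in> connected_cayley_digraphs (dihedral_group p)"
    then obtain U where U: "U \<subseteq> carrier (dihedral_group p)" "\<one>\<^bsub>dihedral_group p\<^esub> \<notin> U"
      "Digraph_Component.connected D" "D = cayley_digraph (dihedral_group p) U"
      by (auto simp: connected_cayley_digraphs_def)
    obtain S where S: "S \<subseteq> V" "U = e ` S" using U(1) unfolding e_image[symmetric] subset_image_iff by blast
    have "(0, False) \<notin> S" using U(2) S(2) e_one by (metis imageI)
    then show "D \<in> cay ` connection_sets" using conn[OF S(1)] U S by (simp add: cay_def[symmetric])
  next
    fix D assume "D \<in> cay ` connection_sets"
    then obtain S where S: "S \<in> connection_sets" "D = cay S" by blast
    have SV: "S \<subseteq> V" "(0, False) \<notin> S" using S by (auto simp: connection_sets_def)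
    have "e (0, False) \<notin> e ` S"
      using SV inj_on_image_mem_iff[OF e_inj zero_in_V SV(1)] by simp
    then show "D \<in> connected_cayley_digraphs (dihedral_group p)"
      using S SV conn[OF SV] e_image e_one
      unfolding connected_cayley_digraphs_def by (auto simp: cay_def intro!: exI[of _ "e ` S"])
  qed
qed

text \<open>The isomorphism class of \<open>cay S\<close> is the image under \<open>cay\<close> of
  the orbit of \<open>S\<close>; as \<open>cay\<close> is injective, distinct orbits have distinct
  images.\<close>

lemma card_iso_classes_eq_card_orbits:
  "card (iso_classes (connected_cayley_digraphs (dihedral_group p)))
    = card (orbits affine_group connection_sets affine_action)"
proof -
  let ?D = "cay ` connection_sets"
  let ?r = "{(X, Y) \<in> ?D \<times> ?D. digraph_iso X Y}"
  interpret group_action affine_group connection_sets affine_action by (rule group_action_affine)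
  have sub: "connection_sets \<subseteq> Pow V" by (auto simp: connection_sets_def)
  have orb: "orbit affine_group affine_action S = {T \<in> connection_sets. digraph_iso (cay S) (cay T)}"
    if S: "S \<in> connection_sets" for S
  proof -
    have mem: "T \<in> orbit affine_group affine_action S \<longleftrightarrow>
        T \<in> connection_sets \<and> (\<exists>a b. (a, b) \<in> carrier affine_group \<and> T = aff a b ` S)" for T
    proof -
      have "T \<in> orbit affine_group affine_action S \<Longrightarrow> T \<in> connection_sets"
        using element_image S by (auto simp: orbit_def)
      moreover have "T \<in> orbit affine_group affine_action S \<longleftrightarrow>
          (\<exists>a b. (a, b) \<in> carrier affine_group \<and> T = aff a b ` S)"
        using S by (auto simp: orbit_def affine_action_def)
      ultimately show ?thesis by blast
    qed
    have iso: "(\<exists>a b. (a, b) \<in> carrier affine_group \<and> T = aff a b ` S) \<longleftrightarrow> digraph_iso (cay S) (cay T)"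
      if "T \<in> connection_sets" for T
      using digraph_iso_cay_iff[of S T] S that sub by (simp only: ex_affine_iff) blast
    show ?thesis
    proof (rule Set.set_eqI)
      fix T
      show "T \<in> orbit affine_group affine_action S \<longleftrightarrow>
          T \<in> {T \<in> connection_sets. digraph_iso (cay S) (cay T)}"
        using mem[of T] iso[of T] by (simp only: mem_Collect_eq) blast
    qed
  qed
  have cls: "?r `` {cay S} = cay ` orbit affine_group affine_action S" if S: "S \<in> connection_sets" for S
    using S by (auto simp: orb)
  have "iso_classes (connected_cayley_digraphs (dihedral_group p)) =
      (\<lambda>C. cay ` C) ` orbits affine_group connection_sets affine_action"
  proof -
    have "iso_classes (connected_cayley_digraphs (dihedral_group p)) = (\<lambda>S. ?r `` {cay S}) ` connection_sets"
      unfolding iso_classes_def connected_cayley_digraphs_eq quotient_def by blast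
    also have "\<dots> = (\<lambda>S. cay ` orbit affine_group affine_action S) ` connection_sets"
      by (intro image_cong refl cls)
    also have "\<dots> = (\<lambda>C. cay ` C) ` orbits affine_group connection_sets affine_action"
      by (auto simp: orbits_def)
    finally show ?thesis .
  qed
  moreover have "inj_on (\<lambda>C. cay ` C) (orbits affine_group connection_sets affine_action)"
  proof (rule inj_on_subset)
    show "inj_on (\<lambda>C. cay ` C) (Pow connection_sets)"
      using inj_on_subset[OF cay_inj sub] by (rule inj_on_image_Pow)
    show "orbits affine_group connection_sets affine_action \<subseteq> Pow connection_sets"
      by (auto simp: orbits_def orb)
  qed
  ultimately show ?thesis by (simp add: card_image)
qed

end

theorem theorem3p5:
  fixes p :: nat
  assumes "prime p" and "odd p"
  shows "real (card (iso_classes (connected_cayley_digraphs (dihedral_group p))))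
           = N_all p - N_c p - 1"
proof -
  interpret odd_prime p using assms by unfold_locales
  obtain e :: "int \<times> bool \<Rightarrow> dihedral_gen word set" where
    "bij_betw e ({0..<int p} \<times> UNIV) (carrier (dihedral_group p))"
    and "\<And>i j a b. e (i, a) \<otimes>\<^bsub>dihedral_group p\<^esub> e (j, b)
        = e ((if a then i - j else i + j) mod int p, a \<noteq> b)"
    and "e (0, False) = \<one>\<^bsub>dihedral_group p\<^esub>"
    using dihedral_coordinates[OF prime_gt_0_nat[OF assms(1)]] by metis
  then interpret dihedral_labelling p e by unfold_locales (simp_all add: V_def)
  show ?thesis by (simp add: card_iso_classes_eq_card_orbits card_orbits_affine_action)
qed

end
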